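(* Let $0<\gamma\le\infty$, $I=[0,\gamma)$, let $w$ be a weight function on $I$ such that $W(\infty)=\infty$ if $\gamma=\infty$, and let $\varphi$ be an Orlicz $N$-function. If $\gamma=\infty$ and $\varphi$ does not satisfy the $\Delta_2$ condition, or $\gamma<\infty$ and $\varphi$ does not satisfy the $\Delta_2^\infty$ condition, then the diameter of any nonempty relatively weakly open subset of the unit ball of the Orlicz-Lorentz space $\Lambda_{\varphi,w}$ equipped with the Luxemburg norm is equal to two.
   Context: Decreasing means non-increasing. $L^0=L^0(I)$ is the set of all (classes of a.e. equal) Lebesgue measurable functions $x:I\to\mathbb{R}$; $m$ is Lebesgue measure. For $x\in L^0$, $d_x(\lambda)=m\{t\in I:|x(t)|>\lambda\}$, $\lambda\ge 0$, and $x^*(t)=\inf\{\lambda\ge 0: d_x(\lambda)\le t\}$, $t\ge 0$, is the decreasing rearrangement (values in $[0,\infty]$, $\inf\emptyset=\infty$). A weight function is a decreasing function $w:I\to(0,\infty)$ that is locally integrable: $W(t)=\int_0^t w<\infty$ for all $t\in I$; if $\gamma=\infty$, $W(\infty)=\int_0^\infty w$. An Orlicz function is a convex $\varphi:[0,\infty)\to[0,\infty)$ with $\varphi(0)=0$ and $\varphi(u)>0$ for $u>0$ (and $\varphi(\infty)=\infty$). It is an Orlicz $N$-function if moreover $\lim_{u\to 0^+}\varphi(u)/u=0$ and $\lim_{u\to\infty}\varphi(u)/u=\infty$. $\varphi$ satisfies $\Delta_2$ if there is $K>0$ with $\varphi(2u)\le K\varphi(u)$ for all $u\ge 0$; it satisfies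 $\Delta_2^\infty$ if there are $K>0$, $u_0\ge 0$ with $\varphi(2u)\le K\varphi(u)$ for all $u\ge u_0$. For $x\in L^0$ let $\rho(x)=\int_0^\gamma\varphi(x^*(t))w(t)\,dt$. The Orlicz-Lorentz space is $\Lambda_{\varphi,w}=\{x\in L^0:\rho(\lambda x)<\infty\text{ for some }\lambda>0\}$, a real Banach space with the Luxemburg norm $\|x\|=\inf\{\epsilon>0:\rho(x/\epsilon)\le 1\}$. The unit ball is the closed unit ball; a relatively weakly open subset of it is its intersection with a weakly open subset of the space; diameter is taken in the Luxemburg norm. *)

theory Defs
  imports "HOL-Analysis.Analysis"
begin

section \<open>The interval and the space of classes of measurable functions\<close>

definition ivl :: "ereal \<Rightarrow> real set" where
  "ivl \<gamma> = {t. 0 \<le> t \<and> ereal t < \<gamma>}"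

text \<open>A measurable function on \<open>I = [0, \<gamma>)\<close> is represented by a total function whose values
  outside \<open>I\<close> are arbitrary. They play no role: the relation below identifies functions that
  agree almost everywhere on \<open>I\<close>.\<close>

definition ae_rel :: "ereal \<Rightarrow> ((real \<Rightarrow> real) \<times> (real \<Rightarrow> real)) set" where
  "ae_rel \<gamma> = {(f, g). f \<in> borel_measurable (lebesgue_on (ivl \<gamma>)) \<and>
                       g \<in> borel_measurable (lebesgue_on (ivl \<gamma>)) \<and>
                       (AE t in lebesgue_on (ivl \<gamma>). f t = g t)}"

definition L0 :: "ereal \<Rightarrow> (real \<Rightarrow> real) set set" where
  "L0 \<gamma> = borel_measurable (lebesgue_on (ivl \<gamma>)) // ae_rel \<gamma>"

definition rep :: "(real \<Rightarrow> real) set \<Rightarrow> real \<Rightarrow> real" where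
  "rep X = (SOME f. f \<in> X)"

definition L0_add :: "ereal \<Rightarrow> (real \<Rightarrow> real) set \<Rightarrow> (real \<Rightarrow> real) set \<Rightarrow> (real \<Rightarrow> real) set" where
  "L0_add \<gamma> X Y = ae_rel \<gamma> `` {\<lambda>t. rep X t + rep Y t}"

definition L0_diff :: "ereal \<Rightarrow> (real \<Rightarrow> real) set \<Rightarrow> (real \<Rightarrow> real) set \<Rightarrow> (real \<Rightarrow> real) set" where
  "L0_diff \<gamma> X Y = ae_rel \<gamma> `` {\<lambda>t. rep X t - rep Y t}"

definition L0_scale :: "ereal \<Rightarrow> real \<Rightarrow> (real \<Rightarrow> real) set \<Rightarrow> (real \<Rightarrow> real) set" where
  "L0_scale \<gamma> c X = ae_rel \<gamma> `` {\<lambda>t. c * rep X t}"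

lemma equiv_ae_rel: "equiv (borel_measurable (lebesgue_on (ivl \<gamma>))) (ae_rel \<gamma>)"
proof (rule equivI)
  show "trans (ae_rel \<gamma>)"
  proof (rule transI)
    fix f g h assume "(f, g) \<in> ae_rel \<gamma>" "(g, h) \<in> ae_rel \<gamma>"
    moreover from this have "AE t in lebesgue_on (ivl \<gamma>). f t = h t"
      unfolding ae_rel_def by (auto elim: eventually_elim2)
    ultimately show "(f, h) \<in> ae_rel \<gamma>"
      by (simp add: ae_rel_def)
  qed
qed (auto simp: ae_rel_def refl_on_def sym_def elim: eventually_mono)

lemma rep_in: "X \<in> L0 \<gamma> \<Longrightarrow> rep X \<in> X"
  unfolding L0_def rep_def
  by (metis equiv_ae_rel in_quotient_imp_non_empty some_in_eq)


section \<open>Decreasing rearrangement\<close>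

definition distr_fun :: "ereal \<Rightarrow> (real \<Rightarrow> real) \<Rightarrow> real \<Rightarrow> ennreal" where
  "distr_fun \<gamma> x s = emeasure lebesgue {t \<in> ivl \<gamma>. \<bar>x t\<bar> > s}"

definition rearr :: "ereal \<Rightarrow> (real \<Rightarrow> real) \<Rightarrow> real \<Rightarrow> ennreal" where
  "rearr \<gamma> x t = Inf {ennreal s |s. 0 \<le> s \<and> distr_fun \<gamma> x s \<le> ennreal t}"


section \<open>Weights\<close>

definition W :: "(real \<Rightarrow> real) \<Rightarrow> ereal \<Rightarrow> ennreal" where
  "W w t = (\<integral>\<^sup>+ s \<in> ivl t. ennreal (w s) \<partial>lebesgue)"

text \<open>Positivity and monotonicity are required on \<open>(0, \<gamma>)\<close> only: the value at the null set \<open>{0}\<close>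
  is irrelevant, and a real value \<open>w 0\<close> dominating all others would force \<open>w\<close> to be bounded
  and make local integrability vacuous, excluding weights such as \<open>t powr (- 1 / 2)\<close>.\<close>

definition weight_function :: "ereal \<Rightarrow> (real \<Rightarrow> real) \<Rightarrow> bool" where
  "weight_function \<gamma> w \<longleftrightarrow>
     (\<forall>t \<in> ivl \<gamma> - {0}. 0 < w t) \<and>
     antimono_on (ivl \<gamma> - {0}) w \<and>
     (\<forall>t \<in> ivl \<gamma>. W w (ereal t) < \<infinity>)"


section \<open>Orlicz functions\<close>

definition orlicz_function :: "(real \<Rightarrow> real) \<Rightarrow> bool" where
  "orlicz_function \<phi> \<longleftrightarrow> convex_on {0..} \<phi> \<and> \<phi> 0 = 0 \<and> (\<forall>u>0. 0 < \<phi> u)"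

definition orlicz_N_function :: "(real \<Rightarrow> real) \<Rightarrow> bool" where
  "orlicz_N_function \<phi> \<longleftrightarrow> orlicz_function \<phi> \<and>
     ((\<lambda>u. \<phi> u / u) \<longlongrightarrow> 0) (at_right 0) \<and>
     filterlim (\<lambda>u. \<phi> u / u) at_top at_top"

definition Delta2 :: "(real \<Rightarrow> real) \<Rightarrow> bool" where
  "Delta2 \<phi> \<longleftrightarrow> (\<exists>K>0. \<forall>u\<ge>0. \<phi> (2 * u) \<le> K * \<phi> u)"

definition Delta2_infinity :: "(real \<Rightarrow> real) \<Rightarrow> bool" where
  "Delta2_infinity \<phi> \<longleftrightarrow> (\<exists>K>0. \<exists>u0\<ge>0. \<forall>u\<ge>u0. \<phi> (2 * u) \<le> K * \<phi> u)"

definition orlicz_ext :: "(real \<Rightarrow> real) \<Rightarrow> ennreal \<Rightarrow> ennreal" where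
  "orlicz_ext \<phi> u = (if u = \<infinity> then \<infinity> else ennreal (\<phi> (enn2real u)))"


section \<open>Orlicz-Lorentz spaces\<close>

definition modular :: "ereal \<Rightarrow> (real \<Rightarrow> real) \<Rightarrow> (real \<Rightarrow> real) \<Rightarrow> (real \<Rightarrow> real) set \<Rightarrow> ennreal" where
  "modular \<gamma> \<phi> w X =
     (\<integral>\<^sup>+ t \<in> ivl \<gamma>. orlicz_ext \<phi> (rearr \<gamma> (rep X) t) * ennreal (w t) \<partial>lebesgue)"

definition orlicz_lorentz ::
    "ereal \<Rightarrow> (real \<Rightarrow> real) \<Rightarrow> (real \<Rightarrow> real) \<Rightarrow> (real \<Rightarrow> real) set set" where
  "orlicz_lorentz \<gamma> \<phi> w = {X \<in> L0 \<gamma>. \<exists>c>0. modular \<gamma> \<phi> w (L0_scale \<gamma> c X) < \<infinity>}"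

definition lux_norm ::
    "ereal \<Rightarrow> (real \<Rightarrow> real) \<Rightarrow> (real \<Rightarrow> real) \<Rightarrow> (real \<Rightarrow> real) set \<Rightarrow> real" where
  "lux_norm \<gamma> \<phi> w X = Inf {e. 0 < e \<and> modular \<gamma> \<phi> w (L0_scale \<gamma> (1 / e) X) \<le> 1}"

definition unit_ball ::
    "ereal \<Rightarrow> (real \<Rightarrow> real) \<Rightarrow> (real \<Rightarrow> real) \<Rightarrow> (real \<Rightarrow> real) set set" where
  "unit_ball \<gamma> \<phi> w = {X \<in> orlicz_lorentz \<gamma> \<phi> w. lux_norm \<gamma> \<phi> w X \<le> 1}"

text \<open>Only the restriction of a functional to the space is relevant.\<close>

definition dual ::
    "ereal \<Rightarrow> (real \<Rightarrow> real) \<Rightarrow> (real \<Rightarrow> real) \<Rightarrow> ((real \<Rightarrow> real) set \<Rightarrow> real) set" where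
  "dual \<gamma> \<phi> w = {F.
     (\<forall>X \<in> orlicz_lorentz \<gamma> \<phi> w. \<forall>Y \<in> orlicz_lorentz \<gamma> \<phi> w. F (L0_add \<gamma> X Y) = F X + F Y) \<and>
     (\<forall>c. \<forall>X \<in> orlicz_lorentz \<gamma> \<phi> w. F (L0_scale \<gamma> c X) = c * F X) \<and>
     (\<exists>C. \<forall>X \<in> orlicz_lorentz \<gamma> \<phi> w. \<bar>F X\<bar> \<le> C * lux_norm \<gamma> \<phi> w X)}"

definition weak_topology ::
    "ereal \<Rightarrow> (real \<Rightarrow> real) \<Rightarrow> (real \<Rightarrow> real) \<Rightarrow> (real \<Rightarrow> real) set topology" where
  "weak_topology \<gamma> \<phi> w =
     topology_generated_by
       {{X \<in> orlicz_lorentz \<gamma> \<phi> w. F X \<in> V} |F V. F \<in> dual \<gamma> \<phi> w \<and> open V}"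

lemma topspace_weak_topology: "topspace (weak_topology \<gamma> \<phi> w) = orlicz_lorentz \<gamma> \<phi> w"
proof -
  have "(\<lambda>_. 0) \<in> dual \<gamma> \<phi> w"
    by (auto simp: dual_def intro: exI[of _ 0])
  then have "\<exists>F V. F \<in> dual \<gamma> \<phi> w \<and> open V \<and>
      orlicz_lorentz \<gamma> \<phi> w = {X \<in> orlicz_lorentz \<gamma> \<phi> w. F X \<in> V}"
    by (intro exI[of _ "\<lambda>_. 0"] exI[of _ UNIV]) auto
  then show ?thesis
    unfolding weak_topology_def topology_generated_by_topspace by blast
qed

definition lux_diameter ::
    "ereal \<Rightarrow> (real \<Rightarrow> real) \<Rightarrow> (real \<Rightarrow> real) \<Rightarrow> (real \<Rightarrow> real) set set \<Rightarrow> ereal" where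
  "lux_diameter \<gamma> \<phi> w S = (SUP (X, Y) \<in> S \<times> S. ereal (lux_norm \<gamma> \<phi> w (L0_diff \<gamma> X Y)))"

end

theory Submission
  imports Defs
begin

text \<open>Layer cake integration in the values of \<open>\<phi> \<circ> \<bar>f\<bar>\<close> and in the levels of \<open>w\<close> turns the modular
  into an integral over \<open>r\<close> of the functionals \<open>\<integral> min t \<bar>{h > s}\<bar> ds\<close> with \<open>h = \<phi> \<circ> \<bar>f\<bar>\<close> and
  \<open>t = \<bar>{w > r}\<bar>\<close>. Such a functional is the minimum over \<open>c\<close> of \<open>t * c + \<integral> (h - c)\<^sup>+\<close>, hence subadditive
  in \<open>h\<close>. So the modular is convex, which bounds the diameter by two, and it is subadditive on
  functions with disjoint supports.

  For the lower bound, failure of the growth condition yields disjointly supported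
  \<open>p k = u k * indicator (A k)\<close> with modulars at most \<open>\<epsilon> / 2 ^ (k + 1)\<close> while \<open>(1 + \<eta>) * p k\<close>
  has modular above one. Sums of the \<open>\<plusminus> p k\<close> stay in the unit ball, so \<open>p k\<close> is weakly null, and so is
  \<open>x * indicator (A k)\<close>. Shrinking a point of the weakly open set slightly to some \<open>x\<close> with modular below one,
  the functions \<open>x\<close> restricted to the complement of \<open>A k\<close>, plus or minus \<open>p k\<close>, lie in the unit ball and
  converge weakly to \<open>x\<close>, and their difference \<open>2 * p k\<close> has norm at least \<open>2 / (1 + \<eta>)\<close>.\<close>

section \<open>Layer cake integrals\<close>

lemma borel_measurable_antimono_ennreal:
  fixes f :: "real \<Rightarrow> ennreal"
  assumes "antimono f"
  shows "f \<in> borel_measurable borel"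
proof (rule borel_measurableI_greater)
  fix a
  have "is_interval {t. a < f t}"
    unfolding is_interval_1
    using assms by (auto simp: antimono_def intro: less_le_trans)
  then show "{x \<in> space borel. a < f x} \<in> sets borel"
    using real_interval_borel_measurable by simp
qed

text \<open>This writes an extended nonnegative number as the length of the set of levels below it,
  the form in which Fubini's theorem can be applied to the values of a function.\<close>

lemma nn_integral_indicator_less:
  "(\<integral>\<^sup>+ s. indicator {s. 0 \<le> s \<and> ennreal s < a} s \<partial>lborel) = a"
proof -
  have m: "{s. 0 \<le> s \<and> ennreal s < a} \<in> sets borel"
    by measurable
  have "emeasure lborel {s. 0 \<le> s \<and> ennreal s < a} = a"
  proof (cases a)
    case (real r)
    then have "{s. 0 \<le> s \<and> ennreal s < a} = {0..<r}"
      by (auto simp: ennreal_less_iff)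
    with real show ?thesis by simp
  next
    case top
    have "{s. 0 \<le> s \<and> ennreal s < a} = {0..}"
      using top by (auto simp: ennreal_less_top)
    moreover have "emeasure lborel {0::real..} = top"
    proof (rule ccontr)
      assume "emeasure lborel {0::real..} \<noteq> top"
      then obtain r where r: "emeasure lborel {0::real..} = ennreal r" "0 \<le> r"
        by (cases "emeasure lborel {0::real..}") auto
      have "emeasure lborel {0..r+1} \<le> emeasure lborel {0::real..}"
        by (rule emeasure_mono) auto
      then show False using r by (simp add: ennreal_le_iff)
    qed
    ultimately show ?thesis using top by simp
  qed
  with m show ?thesis by simp
qed

text \<open>Each value \<open>f x\<close> is replaced by the length of the levels below it, and the
  integrals over points and levels are exchanged.\<close>

lemma (in sigma_finite_measure) nn_integral_layer_cake:
  assumes [measurable]: "f \<in> borel_measurable M"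
  shows "(\<integral>\<^sup>+ x. f x \<partial>M)
       = (\<integral>\<^sup>+ s \<in> {0..}. emeasure M {x \<in> space M. ennreal s < f x} \<partial>lborel)"
proof -
  interpret P: pair_sigma_finite lborel M
    by (simp add: pair_sigma_finite_def sigma_finite_measure_axioms sigma_finite_lborel)
  have "(\<integral>\<^sup>+ x. f x \<partial>M)
      = (\<integral>\<^sup>+ x. \<integral>\<^sup>+ s. indicator {s. 0 \<le> s \<and> ennreal s < f x} s \<partial>lborel \<partial>M)"
    by (simp only: nn_integral_indicator_less)
  also have "\<dots> = (\<integral>\<^sup>+ s. \<integral>\<^sup>+ x. indicator {s. 0 \<le> s \<and> ennreal s < f x} s \<partial>M \<partial>lborel)"
    by (rule P.Fubini') measurable
  also have "\<dots> = (\<integral>\<^sup>+ s \<in> {0..}. emeasure M {x \<in> space M. ennreal s < f x} \<partial>lborel)"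
  proof (rule nn_integral_cong)
    fix s :: real
    have "(\<integral>\<^sup>+ x. indicator {s. 0 \<le> s \<and> ennreal s < f x} s \<partial>M)
        = (\<integral>\<^sup>+ x. indicator {0..} s * indicator {x \<in> space M. ennreal s < f x} x \<partial>M)"
      by (rule nn_integral_cong) (auto simp: indicator_def)
    also have "\<dots> = indicator {0..} s * emeasure M {x \<in> space M. ennreal s < f x}"
      by (subst nn_integral_cmult) auto
    finally show "(\<integral>\<^sup>+ x. indicator {s. 0 \<le> s \<and> ennreal s < f x} s \<partial>M)
        = emeasure M {x \<in> space M. ennreal s < f x} * indicator {0..} s"
      by (simp add: mult.commute)
  qed
  finally show ?thesis .
qed

text \<open>For nonnegative \<open>h\<close> this is the integral over [0, t] of the decreasing
  rearrangement of \<open>h\<close>, that is, Peetre's K-functional of \<open>h\<close> between L1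
  and L infinity. The form through the distribution function avoids the rearrangement.\<close>

definition trunc_integral :: "'a measure \<Rightarrow> ennreal \<Rightarrow> ('a \<Rightarrow> real) \<Rightarrow> ennreal" where
  "trunc_integral M t h
     = (\<integral>\<^sup>+ s \<in> {0..}. min t (emeasure M {x \<in> space M. s < h x}) \<partial>lborel)"

lemma borel_measurable_distribution [measurable]:
  assumes [measurable]: "h \<in> borel_measurable M"
  shows "(\<lambda>s::real. emeasure M {x \<in> space M. s < h x}) \<in> borel_measurable borel"
  by (rule borel_measurable_antimono_ennreal) (auto simp: antimono_def intro!: emeasure_mono)

text \<open>Since \<open>ennreal\<close> sends negative numbers to 0, the integrand on the left is
  the positive part of \<open>h - c\<close>. Its levels are those of \<open>h\<close> shifted down
  by \<open>c\<close>.\<close>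

lemma (in sigma_finite_measure) nn_integral_diff_layer_cake:
  assumes [measurable]: "h \<in> borel_measurable M" and "0 \<le> (c::real)"
  shows "(\<integral>\<^sup>+ x. ennreal (h x - c) \<partial>M)
       = (\<integral>\<^sup>+ s \<in> {c..}. emeasure M {x \<in> space M. s < h x} \<partial>lborel)"
proof -
  have "(\<integral>\<^sup>+ x. ennreal (h x - c) \<partial>M)
      = (\<integral>\<^sup>+ s \<in> {0..}. emeasure M {x \<in> space M. ennreal s < ennreal (h x - c)} \<partial>lborel)"
    by (rule nn_integral_layer_cake) measurable
  also have "\<dots> = (\<integral>\<^sup>+ s \<in> {0..}. emeasure M {x \<in> space M. c + s < h x} \<partial>lborel)"
    by (intro nn_integral_cong)
       (auto simp: indicator_def ennreal_less_iff algebra_simps intro!: arg_cong[where f="emeasure M"])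
  also have "\<dots> = (\<integral>\<^sup>+ s. emeasure M {x \<in> space M. c + 1 * s < h x} * indicator {c..} (c + 1 * s) \<partial>lborel)"
    by (intro nn_integral_cong) (auto simp: indicator_def)
  also have "\<dots> = (\<integral>\<^sup>+ s \<in> {c..}. emeasure M {x \<in> space M. s < h x} \<partial>lborel)"
    by (subst nn_integral_real_affine[where c=1 and t=c
          and f="\<lambda>s. emeasure M {x \<in> space M. s < h x} * indicator {c..} s"]) auto
  finally show ?thesis .
qed

text \<open>The minimum is estimated by \<open>t\<close> below the level \<open>c\<close> and by the
  distribution function above it.\<close>

lemma (in sigma_finite_measure) trunc_integral_le:
  assumes [measurable]: "h \<in> borel_measurable M" and c: "0 \<le> (c::real)"
  shows "trunc_integral M t h \<le> t * ennreal c + (\<integral>\<^sup>+ x. ennreal (h x - c) \<partial>M)"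
proof -
  let ?D = "\<lambda>s. emeasure M {x \<in> space M. s < h x}"
  have "trunc_integral M t h \<le> (\<integral>\<^sup>+ s. t * indicator {0..<c} s + ?D s * indicator {c..} s \<partial>lborel)"
    unfolding trunc_integral_def by (intro nn_integral_mono) (auto simp: indicator_def)
  also have "\<dots> = t * ennreal c + (\<integral>\<^sup>+ x. ennreal (h x - c) \<partial>M)"
    unfolding nn_integral_diff_layer_cake[OF assms]
    by (subst nn_integral_add) (use c in \<open>auto simp: nn_integral_cmult\<close>)
  finally show ?thesis .
qed

text \<open>The bound of \<open>trunc_integral_le\<close> is sharp at the level where the
  distribution function drops to \<open>t\<close>: below it the minimum is \<open>t\<close>, above
  it the distribution function. Such a level exists, because otherwise the integrand would be the
  positive constant \<open>t\<close> on a half line.\<close>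

lemma (in sigma_finite_measure) trunc_integral_attained:
  assumes [measurable]: "h \<in> borel_measurable M" and t: "t \<noteq> 0"
    and fin: "trunc_integral M t h \<noteq> \<infinity>"
  shows "\<exists>c\<ge>0. trunc_integral M t h = t * ennreal c + (\<integral>\<^sup>+ x. ennreal (h x - c) \<partial>M)"
proof -
  let ?D = "\<lambda>s. emeasure M {x \<in> space M. s < h x}"
  let ?S = "{s. 0 \<le> s \<and> ?D s \<le> t}"
  define c where "c = Inf ?S"
  have mono: "?D s' \<le> ?D s" if "s \<le> s'" for s s'
    using that by (auto intro!: emeasure_mono)
  have bdd: "bdd_below ?S" by (auto intro: bdd_belowI[of _ 0])
  have ne: "?S \<noteq> {}"
  proof
    assume empty: "?S = {}"
    have "t < ?D s" if "0 \<le> s" for s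
    proof -
      have "s \<notin> ?S" using empty by blast
      with that show ?thesis by (simp add: not_le)
    qed
    then have "trunc_integral M t h = (\<integral>\<^sup>+ s. t * indicator {0::real..} s \<partial>lborel)"
      unfolding trunc_integral_def
      by (intro nn_integral_cong) (auto simp: indicator_def min_absorb1 less_imp_le)
    also have "\<dots> = t * emeasure lborel {0::real..}"
      by (simp add: nn_integral_cmult)
    also have "emeasure lborel {0::real..} = \<infinity>"
    proof -
      have "{s. 0 \<le> s \<and> ennreal s < top} = {0..}" by auto
      with nn_integral_indicator_less[of top] show ?thesis by simp
    qed
    finally show False using fin t by (simp add: ennreal_mult_top)
  qed
  have c0: "0 \<le> c" unfolding c_def using ne by (intro cInf_greatest) auto
  have lo: "t < ?D s" if "0 \<le> s" "s < c" for s
  proof (rule ccontr)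
    assume "\<not> t < ?D s"
    with that have "s \<in> ?S" by simp
    from cInf_lower[OF this bdd] that show False by (simp add: c_def)
  qed
  have hi: "?D s \<le> t" if less: "c < s" for s
  proof -
    obtain s' where "s' \<in> ?S" "s' < s"
      using cInf_lessD[OF ne, of s] less by (auto simp: c_def)
    then show ?thesis using mono[of s' s] by auto
  qed
  have "trunc_integral M t h = (\<integral>\<^sup>+ s. t * indicator {0..<c} s + ?D s * indicator {c..} s \<partial>lborel)"
    unfolding trunc_integral_def
  proof (rule nn_integral_cong_AE)
    \<comment> \<open>Discarding the single level \<open>c\<close> avoids an appeal to the right
      continuity of the distribution function.\<close>
    show "AE s in lborel. min t (?D s) * indicator {0..} s
        = t * indicator {0..<c} s + ?D s * indicator {c..} s"
      using AE_lborel_singleton[of c]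
    proof eventually_elim
      case (elim s)
      then show ?case
        using lo[of s] hi[of s] c0 by (auto simp: indicator_def min_def not_le)
    qed
  qed
  also have "\<dots> = t * ennreal c + (\<integral>\<^sup>+ x. ennreal (h x - c) \<partial>M)"
    unfolding nn_integral_diff_layer_cake[OF assms(1) c0]
    by (subst nn_integral_add) (use c0 in \<open>auto simp: nn_integral_cmult\<close>)
  finally show ?thesis using c0 by blast
qed

text \<open>If \<open>c\<close> and \<open>d\<close> are optimal levels for \<open>g\<close> and
  \<open>h\<close>, then \<open>c + d\<close> is an admissible level for the sum, and the positive
  part of a sum is at most the sum of the positive parts. The rearrangement itself is not pointwise
  subadditive; only its integrals from 0 are.\<close>

lemma (in sigma_finite_measure) trunc_integral_add:
  assumes [measurable]: "g \<in> borel_measurable M" "h \<in> borel_measurable M"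
  shows "trunc_integral M t (\<lambda>x. g x + h x) \<le> trunc_integral M t g + trunc_integral M t h"
proof (cases "t = 0 \<or> trunc_integral M t g = \<infinity> \<or> trunc_integral M t h = \<infinity>")
  case True
  then show ?thesis by (auto simp: trunc_integral_def)
next
  case False
  then obtain c d where c: "0 \<le> c" "trunc_integral M t g = t * ennreal c + (\<integral>\<^sup>+ x. ennreal (g x - c) \<partial>M)"
    and d: "0 \<le> d" "trunc_integral M t h = t * ennreal d + (\<integral>\<^sup>+ x. ennreal (h x - d) \<partial>M)"
    using trunc_integral_attained[of g t] trunc_integral_attained[of h t] by auto
  have "trunc_integral M t (\<lambda>x. g x + h x)
      \<le> t * ennreal (c + d) + (\<integral>\<^sup>+ x. ennreal (g x + h x - (c + d)) \<partial>M)"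
    using c d by (intro trunc_integral_le) auto
  also have "(\<integral>\<^sup>+ x. ennreal (g x + h x - (c + d)) \<partial>M)
      \<le> (\<integral>\<^sup>+ x. ennreal (g x - c) + ennreal (h x - d) \<partial>M)"
  proof (rule nn_integral_mono)
    fix x
    have "ennreal (g x + h x - (c + d)) \<le> ennreal (max 0 (g x - c) + max 0 (h x - d))"
      by (intro ennreal_leI) auto
    also have "\<dots> = ennreal (max 0 (g x - c)) + ennreal (max 0 (h x - d))"
      by (intro ennreal_plus) auto
    also have "\<dots> = ennreal (g x - c) + ennreal (h x - d)"
      by (simp add: max_def ennreal_neg)
    finally show "ennreal (g x + h x - (c + d)) \<le> \<dots>" .
  qed
  also have "\<dots> = (\<integral>\<^sup>+ x. ennreal (g x - c) \<partial>M) + (\<integral>\<^sup>+ x. ennreal (h x - d) \<partial>M)"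
    by (rule nn_integral_add) auto
  finally show ?thesis
    using c d by (simp add: ennreal_plus distrib_left ac_simps add_left_mono)
qed

lemma trunc_integral_mono:
  assumes [measurable]: "h \<in> borel_measurable M" and "AE x in M. g x \<le> h x"
  shows "trunc_integral M t g \<le> trunc_integral M t h"
  unfolding trunc_integral_def
  by (intro nn_integral_mono mult_right_mono min.mono order_refl emeasure_mono_AE)
     (use assms(2) in \<open>auto elim!: eventually_mono\<close>)

lemma trunc_integral_scale:
  assumes [measurable]: "h \<in> borel_measurable M" and c: "0 < c"
  shows "trunc_integral M t (\<lambda>x. c * h x) = ennreal c * trunc_integral M t h"
proof -
  let ?f = "\<lambda>s. min t (emeasure M {x \<in> space M. s < c * h x}) * indicator {0..} s"
  have "trunc_integral M t (\<lambda>x. c * h x) = \<bar>c\<bar> * (\<integral>\<^sup>+ s. ?f (0 + c * s) \<partial>lborel)"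
    unfolding trunc_integral_def by (rule nn_integral_real_affine) (use c in auto)
  also have "(\<integral>\<^sup>+ s. ?f (0 + c * s) \<partial>lborel) = trunc_integral M t h"
    unfolding trunc_integral_def
    using c by (intro nn_integral_cong) (auto simp: indicator_def zero_le_mult_iff)
  finally show ?thesis using c by simp
qed

section \<open>Lebesgue measure on the interval and the decreasing rearrangement\<close>

lemma sigma_finite_lebesgue: "sigma_finite_measure (lebesgue :: real measure)"
proof
  obtain A :: "real set set" where A: "countable A" "A \<subseteq> sets lborel" "\<Union>A = space lborel"
      "\<forall>a\<in>A. emeasure lborel a \<noteq> \<infinity>"
    using lborel.sigma_finite_countable by metis
  then show "\<exists>A::real set set. countable A \<and> A \<subseteq> sets lebesgue \<and> \<Union>A = space lebesgue \<and>
      (\<forall>a\<in>A. emeasure lebesgue a \<noteq> \<infinity>)"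
    by (intro exI[of _ A]) auto
qed

lemma ivl_measurable [measurable]: "ivl \<gamma> \<in> sets borel"
  unfolding ivl_def by measurable

lemma sigma_finite_lebesgue_on_ivl: "sigma_finite_measure (lebesgue_on (ivl \<gamma>))"
  by (intro sigma_finite_measure_restrict_space sigma_finite_lebesgue) auto

lemma distr_fun_eq:
  "distr_fun \<gamma> f s = emeasure (lebesgue_on (ivl \<gamma>)) {x \<in> space (lebesgue_on (ivl \<gamma>)). s < \<bar>f x\<bar>}"
  unfolding distr_fun_def by (subst emeasure_restrict_space) auto

text \<open>Rearrangement and distribution function are generalized inverses of each other. The
  delicate direction is that the infimum in \<open>rearr\<close> is attained; this is right
  continuity of the distribution function, obtained by exhausting the superlevel set at
  \<open>s\<close> by those at \<open>s + 1 / Suc n\<close>.\<close>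

lemma less_rearr_iff:
  assumes [measurable]: "f \<in> borel_measurable (lebesgue_on (ivl \<gamma>))" and s: "0 \<le> s"
  shows "ennreal s < rearr \<gamma> f t \<longleftrightarrow> ennreal t < distr_fun \<gamma> f s"
proof -
  let ?M = "lebesgue_on (ivl \<gamma>)"
  have "rearr \<gamma> f t \<le> ennreal s \<longleftrightarrow> distr_fun \<gamma> f s \<le> ennreal t"
  proof
    assume "distr_fun \<gamma> f s \<le> ennreal t"
    then show "rearr \<gamma> f t \<le> ennreal s"
      unfolding rearr_def using s by (intro Inf_lower) auto
  next
    assume le: "rearr \<gamma> f t \<le> ennreal s"
    define A where "A n = {x \<in> space ?M. s + 1 / Suc n < \<bar>f x\<bar>}" for n
    have A_le: "emeasure ?M (A n) \<le> ennreal t" for n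
    proof -
      have "0 < 1 / real (Suc n)" by simp
      then have "ennreal s < ennreal (s + 1 / Suc n)"
        using s by (intro ennreal_lessI) linarith+
      with le have "rearr \<gamma> f t < ennreal (s + 1 / Suc n)"
        by (rule le_less_trans)
      then obtain s' where s': "0 \<le> s'" "distr_fun \<gamma> f s' \<le> ennreal t" "s' < s + 1 / Suc n"
        unfolding rearr_def by (auto simp: Inf_less_iff ennreal_less_iff)
      have "emeasure ?M (A n) \<le> distr_fun \<gamma> f s'"
        unfolding distr_fun_eq A_def
      proof (rule emeasure_mono)
        show "{x \<in> space ?M. s + 1 / Suc n < \<bar>f x\<bar>} \<subseteq> {x \<in> space ?M. s' < \<bar>f x\<bar>}"
          using s'(3) by auto
      qed measurable
      with s' show ?thesis by simp
    qed
    have "(\<Union>n. A n) = {x \<in> space ?M. s < \<bar>f x\<bar>}"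
    proof (intro set_eqI iffI)
      fix x assume x: "x \<in> {x \<in> space ?M. s < \<bar>f x\<bar>}"
      then obtain n where "inverse (of_nat (Suc n)) < \<bar>f x\<bar> - s"
        using reals_Archimedean[of "\<bar>f x\<bar> - s"] by auto
      with x show "x \<in> (\<Union>n. A n)" by (auto simp: A_def inverse_eq_divide intro!: exI[of _ n])
    next
      fix x assume "x \<in> (\<Union>n. A n)"
      then obtain n where "x \<in> space ?M" "s + 1 / Suc n < \<bar>f x\<bar>" by (auto simp: A_def)
      moreover have "0 < 1 / real (Suc n)" by simp
      ultimately have "x \<in> space ?M" "s < \<bar>f x\<bar>" by linarith+
      then show "x \<in> {x \<in> space ?M. s < \<bar>f x\<bar>}" by simp
    qed
    moreover have "(SUP n. emeasure ?M (A n)) = emeasure ?M (\<Union>n. A n)"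
    proof (rule SUP_emeasure_incseq)
      have "A n \<in> sets ?M" for n unfolding A_def by measurable
      then show "range A \<subseteq> sets ?M" by blast
      show "incseq A"
      proof (rule incseq_SucI)
        fix n
        have "1 / real (Suc (Suc n)) \<le> 1 / real (Suc n)" by (simp add: field_simps)
        then show "A n \<le> A (Suc n)" unfolding A_def by auto
      qed
    qed
    ultimately have "distr_fun \<gamma> f s = (SUP n. emeasure ?M (A n))"
      unfolding distr_fun_eq by simp
    also have "\<dots> \<le> ennreal t"
      by (intro SUP_least A_le)
    finally show "distr_fun \<gamma> f s \<le> ennreal t" .
  qed
  then show ?thesis by (simp flip: not_le)
qed

lemma antimono_rearr: "antimono (rearr \<gamma> f)"
proof (rule antimonoI)
  fix x y :: real assume "x \<le> y"
  then have "distr_fun \<gamma> f s \<le> ennreal y" if "distr_fun \<gamma> f s \<le> ennreal x" for s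
    using that ennreal_leI[of x y] \<open>x \<le> y\<close> by (meson order_trans)
  then show "rearr \<gamma> f y \<le> rearr \<gamma> f x"
    unfolding rearr_def by (intro Inf_superset_mono) blast
qed

text \<open>Up to its right end point \<open>B\<close> is an interval starting at 0, so cutting it
  at \<open>a\<close> leaves the shorter of two such intervals. Negative numbers are kept out of
  \<open>B\<close> because \<open>ennreal\<close> maps them to 0, below every positive
  \<open>a\<close>.\<close>

lemma emeasure_Int_initial:
  fixes B :: "real set"
  assumes [measurable]: "B \<in> sets borel" and "B \<subseteq> {0<..}"
    and down: "\<And>x y. y \<in> B \<Longrightarrow> 0 < x \<Longrightarrow> x \<le> y \<Longrightarrow> x \<in> B"
  shows "emeasure lborel (B \<inter> {t. ennreal t < a}) = min (emeasure lborel B) a"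
proof (cases a)
  case top
  then show ?thesis by (simp add: ennreal_less_top)
next
  case (real r)
  show ?thesis
  proof (cases "\<exists>b\<in>B. r \<le> b")
    case True
    then obtain b where b: "b \<in> B" "r \<le> b" by blast
    have "B \<inter> {t. ennreal t < a} = {0<..<r}"
      using real b assms(2) down[OF b(1)] by (auto simp: ennreal_less_iff)
    moreover have "emeasure lborel {0<..<r} \<le> emeasure lborel B"
      using b(2) down[OF b(1)] by (intro emeasure_mono) auto
    ultimately show ?thesis using real by (simp add: min_def)
  next
    case False
    then have "B \<inter> {t. ennreal t < a} = B" "B \<subseteq> {0<..<r}"
      using real assms(2) by (auto simp: ennreal_less_iff not_le)
    moreover from this have "emeasure lborel B \<le> emeasure lborel {0<..<r}"
      by (intro emeasure_mono) auto
    ultimately show ?thesis using real by (simp add: min_def)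
  qed
qed

section \<open>Orlicz-Lorentz spaces\<close>

locale orlicz_lorentz_space =
  fixes \<gamma> :: ereal and w \<phi> :: "real \<Rightarrow> real"
  assumes gamma_pos: "0 < \<gamma>"
    and weight: "weight_function \<gamma> w"
    and orlicz: "orlicz_function \<phi>"
begin

section \<open>The weighted measure and the superlevel sets of the weight\<close>

abbreviation M :: "real measure" where "M \<equiv> lebesgue_on (ivl \<gamma>)"

sublocale M: sigma_finite_measure M
  by (rule sigma_finite_lebesgue_on_ivl)

text \<open>The point 0 is cut out because \<open>weight_function\<close> does not constrain
  \<open>w 0\<close>; after this every superlevel set is an interval with left end 0.\<close>

definition wgt :: "real \<Rightarrow> ennreal" where
  "wgt t = ennreal (w t) * indicator (ivl \<gamma> - {0}) t"

definition \<nu> :: "real measure" where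
  "\<nu> = density lborel wgt"

lemma w_pos: "t \<in> ivl \<gamma> - {0} \<Longrightarrow> 0 < w t"
  using weight by (auto simp: weight_function_def)

lemma w_antimono: "s \<in> ivl \<gamma> - {0} \<Longrightarrow> t \<in> ivl \<gamma> - {0} \<Longrightarrow> s \<le> t \<Longrightarrow> w t \<le> w s"
  using weight by (auto simp: weight_function_def monotone_on_def)

lemma ivl_down: "t \<in> ivl \<gamma> \<Longrightarrow> 0 \<le> s \<Longrightarrow> s \<le> t \<Longrightarrow> s \<in> ivl \<gamma>"
  unfolding ivl_def by (auto intro: le_less_trans[of "ereal s" "ereal t"])

lemma wgt_less_iff: "a < wgt t \<longleftrightarrow> t \<in> ivl \<gamma> - {0} \<and> a < ennreal (w t)"
  unfolding wgt_def by (auto simp: indicator_def)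

lemma wgt_down:
  assumes "a < wgt t" "0 < s" "s \<le> t"
  shows "a < wgt s"
proof -
  have t: "t \<in> ivl \<gamma> - {0}" "a < ennreal (w t)" using assms(1) by (auto simp: wgt_less_iff)
  moreover have "s \<in> ivl \<gamma> - {0}" using ivl_down[of t s] t assms by auto
  moreover have "ennreal (w t) \<le> ennreal (w s)"
    by (intro ennreal_leI w_antimono) (use calculation assms in auto)
  ultimately show ?thesis unfolding wgt_less_iff by (auto intro: less_le_trans)
qed

lemma wgt_pos_arg: "a < wgt t \<Longrightarrow> 0 < t"
  by (auto simp: wgt_less_iff ivl_def)

lemma wgt_measurable [measurable]: "wgt \<in> borel_measurable borel"
proof (rule borel_measurableI_greater)
  fix a
  have "is_interval {t. a < wgt t}"
    unfolding is_interval_1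
  proof (intro ballI allI impI)
    fix x y z assume "x \<in> {t. a < wgt t}" "y \<in> {t. a < wgt t}" and z: "x \<le> z \<and> z \<le> y"
    then have "0 < x" "a < wgt y" by (auto dest: wgt_pos_arg)
    then show "z \<in> {t. a < wgt t}" using z wgt_down[of a y z] by simp
  qed
  then show "{t \<in> space borel. a < wgt t} \<in> sets borel"
    using real_interval_borel_measurable by simp
qed

lemma sets_nu [simp, measurable_cong]: "sets \<nu> = sets borel"
  by (simp add: \<nu>_def)

lemma space_nu [simp]: "space \<nu> = UNIV"
  by (simp add: \<nu>_def)

sublocale nu: sigma_finite_measure \<nu>
  unfolding \<nu>_def
  by (subst sigma_finite_measure.sigma_finite_iff_density_finite[OF sigma_finite_lborel])
     (auto simp: wgt_def indicator_def)

text \<open>Essentially the generalized inverse of the decreasing weight; its values serve as the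
  truncation \<open>t\<close> in \<open>trunc_integral\<close>.\<close>

definition height_measure :: "real \<Rightarrow> ennreal" where
  "height_measure r = emeasure lborel {t. ennreal r < wgt t}"

lemma antimono_height_measure: "antimono height_measure"
  unfolding height_measure_def
  by (intro antimonoI emeasure_mono) (auto intro: le_less_trans ennreal_leI)

lemma height_measure_measurable [measurable]: "height_measure \<in> borel_measurable borel"
  by (rule borel_measurable_antimono_ennreal[OF antimono_height_measure])

text \<open>Layer cake in the height \<open>r\<close> of the weight. Here the monotonicity of
  \<open>w\<close> enters: the superlevel sets are initial intervals, so their intersection with
  another initial interval has the smaller of the two lengths.\<close>

lemma emeasure_nu_initial:
  "emeasure \<nu> {t. ennreal t < a} = (\<integral>\<^sup>+ r \<in> {0..}. min (height_measure r) a \<partial>lborel)"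
proof -
  have initial: "emeasure lborel ({t. ennreal r < wgt t} \<inter> {t. ennreal t < a})
      = min (emeasure lborel {t. ennreal r < wgt t}) a" for r
  proof (rule emeasure_Int_initial)
    show "{t. ennreal r < wgt t} \<in> sets borel" by measurable
    show "{t. ennreal r < wgt t} \<subseteq> {0<..}" using wgt_pos_arg by blast
    show "x \<in> {t. ennreal r < wgt t}" if "y \<in> {t. ennreal r < wgt t}" "0 < x" "x \<le> y" for x y
      using that wgt_down[of "ennreal r" y x] by simp
  qed
  have "emeasure \<nu> {t. ennreal t < a} = (\<integral>\<^sup>+ t \<in> {t. ennreal t < a}. wgt t \<partial>lborel)"
    unfolding \<nu>_def by (rule emeasure_density) measurable
  also have "\<dots> = (\<integral>\<^sup>+ r \<in> {0..}. emeasure lborel {t \<in> space lborel.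
      ennreal r < wgt t * indicator {t. ennreal t < a} t} \<partial>lborel)"
    by (rule lborel.nn_integral_layer_cake) measurable
  also have "\<dots> = (\<integral>\<^sup>+ r \<in> {0..}. min (height_measure r) a \<partial>lborel)"
  proof (intro nn_integral_cong arg_cong2[where f="(*)"] refl)
    fix r :: real
    have "{t \<in> space lborel. ennreal r < wgt t * indicator {t. ennreal t < a} t}
        = {t. ennreal r < wgt t} \<inter> {t. ennreal t < a}"
      by (auto simp: indicator_def)
    then show "emeasure lborel {t \<in> space lborel.
        ennreal r < wgt t * indicator {t. ennreal t < a} t} = min (height_measure r) a"
      unfolding height_measure_def
      using initial[of r] by simp
  qed
  finally show ?thesis .
qed

section \<open>The Orlicz function as an increasing bijection of the half line\<close>

lemma phi_0 [simp]: "\<phi> 0 = 0"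
  and phi_pos: "0 < u \<Longrightarrow> 0 < \<phi> u"
  and phi_convex: "convex_on {0..} \<phi>"
  using orlicz by (auto simp: orlicz_function_def)

lemma phi_nonneg: "0 \<le> u \<Longrightarrow> 0 \<le> \<phi> u"
  using phi_pos[of u] by (cases "u = 0") auto

lemma phi_combine:
  assumes "0 \<le> \<theta>" "\<theta> \<le> 1" "0 \<le> u" "0 \<le> v"
  shows "\<phi> (\<theta> * u + (1 - \<theta>) * v) \<le> \<theta> * \<phi> u + (1 - \<theta>) * \<phi> v"
  using convex_onD[OF phi_convex, of \<theta> v u] assms by (simp add: algebra_simps)

lemma phi_shrink:
  assumes "0 \<le> \<theta>" "\<theta> \<le> 1" "0 \<le> u"
  shows "\<phi> (\<theta> * u) \<le> \<theta> * \<phi> u"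
  using phi_combine[OF assms, of 0] by simp

lemma phi_strict_mono:
  assumes "0 \<le> s" "s < t"
  shows "\<phi> s < \<phi> t"
proof -
  have "\<phi> (s / t * t) \<le> s / t * \<phi> t" using assms by (intro phi_shrink) auto
  moreover have "s / t * \<phi> t < 1 * \<phi> t"
    using assms phi_pos[of t] by (intro mult_strict_right_mono) auto
  ultimately show ?thesis using assms by simp
qed

lemma phi_less_iff: "0 \<le> s \<Longrightarrow> 0 \<le> t \<Longrightarrow> \<phi> s < \<phi> t \<longleftrightarrow> s < t"
  using phi_strict_mono[of s t] phi_strict_mono[of t s] by (cases s t rule: linorder_cases) auto

lemma phi_mono: "0 \<le> s \<Longrightarrow> s \<le> t \<Longrightarrow> \<phi> s \<le> \<phi> t"
  using phi_strict_mono[of s t] by (cases "s = t") auto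

lemma phi_at_least: "1 \<le> u \<Longrightarrow> u * \<phi> 1 \<le> \<phi> u"
  using phi_shrink[of "1 / u" u] by (simp add: field_simps)

text \<open>Used to pull a level of \<open>\<phi> \<circ> \<bar>f\<bar>\<close> back to a level of
  \<open>\<bar>f\<bar>\<close>. Convexity puts \<open>\<phi>\<close> below its chord on [0, 1] and
  above the extended chord beyond 1, so \<open>l\<close> lies between the values at \<open>a\<close>
  and \<open>b\<close>. The choice \<open>a > 0\<close> keeps the interval inside the open half
  line, where convexity gives continuity.\<close>

lemma phi_surj:
  assumes "0 \<le> l"
  shows "\<exists>s\<ge>0. \<phi> s = l"
proof (cases "l = 0")
  case False
  with assms have l: "0 < l" by simp
  define a where "a = min 1 (l / \<phi> 1)"
  define b where "b = max 1 (l / \<phi> 1)"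
  note p1 = phi_pos[of 1]
  have a: "0 < a" "a \<le> 1" "a * \<phi> 1 \<le> l"
    using l p1 by (auto simp: a_def min_def field_simps)
  have b: "1 \<le> b" "l \<le> b * \<phi> 1"
    using l p1 by (auto simp: b_def max_def field_simps)
  have "continuous_on {0<..} \<phi>"
    by (intro convex_on_continuous convex_on_subset[OF phi_convex]) auto
  then have "continuous_on {a..b} \<phi>"
    by (rule continuous_on_subset) (use a in auto)
  moreover have "\<phi> a \<le> l" using phi_shrink[of a 1] a by simp
  moreover have "l \<le> \<phi> b" using phi_at_least[of b] b by simp
  ultimately obtain s where "a \<le> s" "s \<le> b" "\<phi> s = l"
    using IVT'[of \<phi> a l b] a b by auto
  with a show ?thesis by (intro exI[of _ s]) auto
qed (auto intro: exI[of _ 0])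

lemma phi_measurable [measurable]:
  assumes [measurable]: "f \<in> borel_measurable N"
  shows "(\<lambda>x. \<phi> \<bar>f x\<bar>) \<in> borel_measurable N"
proof -
  \<comment> \<open>Nothing is known about \<open>\<phi>\<close> on negative numbers;
    \<open>max 0\<close> extends it monotonically to the line.\<close>
  have "mono (\<lambda>u. \<phi> (max 0 u))"
    by (intro monoI phi_mono) auto
  then have [measurable]: "(\<lambda>u. \<phi> (max 0 u)) \<in> borel_measurable borel"
    by (rule borel_measurable_mono)
  have "(\<lambda>x. \<phi> (max 0 \<bar>f x\<bar>)) \<in> borel_measurable N" by measurable
  then show ?thesis by simp
qed

lemma less_orlicz_ext_iff:
  assumes "0 \<le> s"
  shows "ennreal (\<phi> s) < orlicz_ext \<phi> v \<longleftrightarrow> ennreal s < v"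
proof (cases v)
  case (real r)
  then show ?thesis using assms phi_nonneg[of s] phi_nonneg[of r]
    by (simp add: orlicz_ext_def ennreal_less_iff phi_less_iff)
qed (simp add: orlicz_ext_def ennreal_less_top)

lemma orlicz_ext_mono:
  assumes "u \<le> v"
  shows "orlicz_ext \<phi> u \<le> orlicz_ext \<phi> v"
proof (cases "v = \<infinity>")
  case False
  with assms have "u \<noteq> \<infinity>" by (auto simp: top_unique)
  moreover have "enn2real u \<le> enn2real v"
    using assms False by (intro enn2real_mono) (auto simp: less_top)
  ultimately show ?thesis
    using False by (auto simp: orlicz_ext_def intro!: ennreal_leI phi_mono)
qed (simp add: orlicz_ext_def)

section \<open>Layer cake form of the modular\<close>

definition fun_modular :: "(real \<Rightarrow> real) \<Rightarrow> ennreal" where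
  "fun_modular f = (\<integral>\<^sup>+ t \<in> ivl \<gamma>. orlicz_ext \<phi> (rearr \<gamma> f t) * ennreal (w t) \<partial>lebesgue)"

text \<open>With \<open>l = \<phi> s\<close>, a level of the rearrangement turns into a level of the
  distribution function by \<open>less_rearr_iff\<close>, and the rearrangement disappears from the
  formula.\<close>

lemma fun_modular_layer_cake:
  assumes [measurable]: "f \<in> borel_measurable M"
  shows "fun_modular f = (\<integral>\<^sup>+ l \<in> {0..}. emeasure \<nu> {t. ennreal t <
      emeasure M {x \<in> space M. l < \<phi> \<bar>f x\<bar>}} \<partial>lborel)"
proof -
  have less: "ennreal l < orlicz_ext \<phi> (rearr \<gamma> f t) \<longleftrightarrow>
      ennreal t < emeasure M {x \<in> space M. l < \<phi> \<bar>f x\<bar>}" if l: "0 \<le> l" for l t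
  proof -
    obtain s where s: "0 \<le> s" "l = \<phi> s" using phi_surj[OF l] by auto
    have "{x \<in> space M. l < \<phi> \<bar>f x\<bar>} = {x \<in> space M. s < \<bar>f x\<bar>}"
      using s by (simp add: phi_less_iff)
    then show ?thesis
      using s by (simp only: less_orlicz_ext_iff less_rearr_iff[OF assms] distr_fun_eq)
  qed
  have "antimono (\<lambda>t. orlicz_ext \<phi> (rearr \<gamma> f t))"
    using antimono_rearr[of \<gamma> f] by (auto simp: antimono_def intro: orlicz_ext_mono)
  then have [measurable]: "(\<lambda>t. orlicz_ext \<phi> (rearr \<gamma> f t)) \<in> borel_measurable borel"
    by (rule borel_measurable_antimono_ennreal)
  have "fun_modular f = (\<integral>\<^sup>+ t. wgt t * orlicz_ext \<phi> (rearr \<gamma> f t) \<partial>lborel)"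
    unfolding fun_modular_def nn_integral_completion
  proof (rule nn_integral_cong_AE)
    show "AE t in lborel. orlicz_ext \<phi> (rearr \<gamma> f t) * ennreal (w t) * indicator (ivl \<gamma>) t
        = wgt t * orlicz_ext \<phi> (rearr \<gamma> f t)"
      using AE_lborel_singleton[of 0]
      by eventually_elim (auto simp: wgt_def indicator_def mult.commute)
  qed
  also have "\<dots> = (\<integral>\<^sup>+ t. orlicz_ext \<phi> (rearr \<gamma> f t) \<partial>\<nu>)"
    unfolding \<nu>_def by (rule nn_integral_density[symmetric]) measurable
  also have "\<dots> = (\<integral>\<^sup>+ l \<in> {0..}. emeasure \<nu> {t \<in> space \<nu>. ennreal l <
      orlicz_ext \<phi> (rearr \<gamma> f t)} \<partial>lborel)"
    by (rule nu.nn_integral_layer_cake) measurable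
  also have "\<dots> = (\<integral>\<^sup>+ l \<in> {0..}. emeasure \<nu> {t. ennreal t <
      emeasure M {x \<in> space M. l < \<phi> \<bar>f x\<bar>}} \<partial>lborel)"
    by (intro nn_integral_cong) (auto simp: indicator_def less)
  finally show ?thesis .
qed

text \<open>For nonnegative \<open>h\<close> this is the Lorentz norm of \<open>h\<close> with
  weight \<open>w\<close>, the integral of the rearrangement against the weight, written as a
  superposition of K-functionals so that it inherits their subadditivity.\<close>

definition lorentz :: "(real \<Rightarrow> real) \<Rightarrow> ennreal" where
  "lorentz h = (\<integral>\<^sup>+ r \<in> {0..}. trunc_integral M (height_measure r) h \<partial>lborel)"

text \<open>Both formulas integrate the same minimum over levels \<open>l\<close> of
  \<open>\<phi> \<circ> \<bar>f\<bar>\<close> and heights \<open>r\<close> of the weight, in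
  opposite orders.\<close>

lemma fun_modular_eq_lorentz:
  assumes [measurable]: "f \<in> borel_measurable M"
  shows "fun_modular f = lorentz (\<lambda>x. \<phi> \<bar>f x\<bar>)"
proof -
  let ?D = "\<lambda>l. emeasure M {x \<in> space M. l < \<phi> \<bar>f x\<bar>}"
  have D [measurable]: "?D \<in> borel_measurable borel"
    by (rule borel_measurable_distribution) measurable
  have "fun_modular f = (\<integral>\<^sup>+ l. \<integral>\<^sup>+ r. min (height_measure r) (?D l) * indicator {0..} r * indicator {0..} l
      \<partial>lborel \<partial>lborel)"
    unfolding fun_modular_layer_cake[OF assms] emeasure_nu_initial
    by (intro nn_integral_cong nn_integral_multc[symmetric]) measurable
  also have "\<dots> = (\<integral>\<^sup>+ r. \<integral>\<^sup>+ l. min (height_measure r) (?D l) * indicator {0..} r * indicator {0..} l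
      \<partial>lborel \<partial>lborel)"
    by (rule lborel_pair.Fubini'[symmetric]) measurable
  also have "\<dots> = (\<integral>\<^sup>+ r. \<integral>\<^sup>+ l. min (height_measure r) (?D l) * indicator {0..} l * indicator {0..} r
      \<partial>lborel \<partial>lborel)"
    by (intro nn_integral_cong) (simp only: ac_simps)
  also have "\<dots> = (\<integral>\<^sup>+ r. (\<integral>\<^sup>+ l. min (height_measure r) (?D l) * indicator {0..} l \<partial>lborel)
      * indicator {0..} r \<partial>lborel)"
    by (intro nn_integral_cong nn_integral_multc) measurable
  finally show ?thesis by (simp add: lorentz_def trunc_integral_def)
qed

lemma trunc_height_measurable [measurable]:
  "(\<lambda>r. trunc_integral M (height_measure r) h) \<in> borel_measurable borel"
  using antimono_height_measure
  by (intro borel_measurable_antimono_ennreal antimonoI)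
     (auto simp: trunc_integral_def antimono_def intro!: nn_integral_mono mult_right_mono min.mono)

lemma lorentz_add:
  assumes [measurable]: "g \<in> borel_measurable M" "h \<in> borel_measurable M"
  shows "lorentz (\<lambda>x. g x + h x) \<le> lorentz g + lorentz h"
proof -
  have "lorentz (\<lambda>x. g x + h x) \<le> (\<integral>\<^sup>+ r. trunc_integral M (height_measure r) g * indicator {0..} r
      + trunc_integral M (height_measure r) h * indicator {0..} r \<partial>lborel)"
    unfolding lorentz_def
    by (intro nn_integral_mono) (auto simp: indicator_def M.trunc_integral_add)
  also have "\<dots> = lorentz g + lorentz h"
    unfolding lorentz_def by (rule nn_integral_add) measurable
  finally show ?thesis .
qed

lemma lorentz_mono:
  assumes "h \<in> borel_measurable M" "AE x in M. g x \<le> h x"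
  shows "lorentz g \<le> lorentz h"
  unfolding lorentz_def using assms by (intro nn_integral_mono mult_right_mono trunc_integral_mono) auto

lemma lorentz_scale:
  assumes [measurable]: "h \<in> borel_measurable M" and c: "0 < c"
  shows "lorentz (\<lambda>x. c * h x) = ennreal c * lorentz h"
  unfolding lorentz_def trunc_integral_scale[OF assms]
  by (subst nn_integral_cmult[symmetric]) (simp_all add: ac_simps)

subsection \<open>The modular and the norm on functions\<close>

lemma fun_modular_mono:
  assumes [measurable]: "f \<in> borel_measurable M" "g \<in> borel_measurable M"
    and "AE x in M. \<bar>f x\<bar> \<le> \<bar>g x\<bar>"
  shows "fun_modular f \<le> fun_modular g"
  unfolding fun_modular_eq_lorentz[OF assms(1)] fun_modular_eq_lorentz[OF assms(2)]
proof (rule lorentz_mono)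
  show "AE x in M. \<phi> \<bar>f x\<bar> \<le> \<phi> \<bar>g x\<bar>"
    using assms(3) by eventually_elim (auto intro: phi_mono)
qed measurable

lemma fun_modular_cong_AE:
  assumes "f \<in> borel_measurable M" "g \<in> borel_measurable M" "AE x in M. f x = g x"
  shows "fun_modular f = fun_modular g"
  using assms by (intro antisym fun_modular_mono) (auto elim!: eventually_mono)

text \<open>Convexity of \<open>\<phi>\<close> gives a pointwise bound, and \<open>lorentz\<close>
  is monotone, subadditive and positively homogeneous.\<close>

lemma fun_modular_convex:
  assumes [measurable]: "f \<in> borel_measurable M" "g \<in> borel_measurable M"
    and th: "0 < \<theta>" "\<theta> < 1"
  shows "fun_modular (\<lambda>x. \<theta> * f x + (1 - \<theta>) * g x) \<le> ennreal \<theta> * fun_modular f + ennreal (1 - \<theta>) * fun_modular g"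
proof -
  have "fun_modular (\<lambda>x. \<theta> * f x + (1 - \<theta>) * g x)
      = lorentz (\<lambda>x. \<phi> \<bar>\<theta> * f x + (1 - \<theta>) * g x\<bar>)"
    by (rule fun_modular_eq_lorentz) measurable
  also have "\<dots> \<le> lorentz (\<lambda>x. \<theta> * \<phi> \<bar>f x\<bar> + (1 - \<theta>) * \<phi> \<bar>g x\<bar>)"
  proof (rule lorentz_mono)
    show "AE x in M. \<phi> \<bar>\<theta> * f x + (1 - \<theta>) * g x\<bar> \<le> \<theta> * \<phi> \<bar>f x\<bar> + (1 - \<theta>) * \<phi> \<bar>g x\<bar>"
    proof (rule AE_I2)
      fix x
      have "\<bar>\<theta> * f x + (1 - \<theta>) * g x\<bar> \<le> \<bar>\<theta> * f x\<bar> + \<bar>(1 - \<theta>) * g x\<bar>"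
        by (rule abs_triangle_ineq)
      also have "\<dots> = \<theta> * \<bar>f x\<bar> + (1 - \<theta>) * \<bar>g x\<bar>"
        using th by (simp add: abs_mult)
      finally have "\<phi> \<bar>\<theta> * f x + (1 - \<theta>) * g x\<bar> \<le> \<phi> (\<theta> * \<bar>f x\<bar> + (1 - \<theta>) * \<bar>g x\<bar>)"
        by (intro phi_mono) auto
      also have "\<dots> \<le> \<theta> * \<phi> \<bar>f x\<bar> + (1 - \<theta>) * \<phi> \<bar>g x\<bar>"
        using th by (intro phi_combine) auto
      finally show "\<phi> \<bar>\<theta> * f x + (1 - \<theta>) * g x\<bar> \<le> \<dots>" .
    qed
  qed measurable
  also have "\<dots> \<le> lorentz (\<lambda>x. \<theta> * \<phi> \<bar>f x\<bar>) + lorentz (\<lambda>x. (1 - \<theta>) * \<phi> \<bar>g x\<bar>)"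
    by (rule lorentz_add) measurable
  also have "lorentz (\<lambda>x. \<theta> * \<phi> \<bar>f x\<bar>) = ennreal \<theta> * fun_modular f"
    unfolding fun_modular_eq_lorentz[OF assms(1)] using th by (intro lorentz_scale) auto
  also have "lorentz (\<lambda>x. (1 - \<theta>) * \<phi> \<bar>g x\<bar>) = ennreal (1 - \<theta>) * fun_modular g"
    unfolding fun_modular_eq_lorentz[OF assms(2)] using th by (intro lorentz_scale) auto
  finally show ?thesis .
qed

lemma fun_modular_shrink:
  assumes [measurable]: "f \<in> borel_measurable M" and th: "0 < \<theta>" "\<theta> \<le> 1"
  shows "fun_modular (\<lambda>x. \<theta> * f x) \<le> ennreal \<theta> * fun_modular f"
proof -
  have "fun_modular (\<lambda>x. \<theta> * f x) = lorentz (\<lambda>x. \<phi> \<bar>\<theta> * f x\<bar>)"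
    by (rule fun_modular_eq_lorentz) measurable
  also have "\<dots> \<le> lorentz (\<lambda>x. \<theta> * \<phi> \<bar>f x\<bar>)"
  proof (rule lorentz_mono)
    show "AE x in M. \<phi> \<bar>\<theta> * f x\<bar> \<le> \<theta> * \<phi> \<bar>f x\<bar>"
      using th by (auto simp: abs_mult intro!: phi_shrink)
  qed measurable
  also have "\<dots> = ennreal \<theta> * fun_modular f"
    unfolding fun_modular_eq_lorentz[OF assms(1)] using th by (intro lorentz_scale) auto
  finally show ?thesis .
qed

text \<open>On disjoint supports \<open>\<phi> \<circ> \<bar>_\<bar>\<close> is additive, so the
  subadditivity of \<open>lorentz\<close> passes to the modular. Equality cannot be expected, since
  rearranging each summand separately moves both to the region of largest weight.\<close>

lemma fun_modular_disjoint:
  assumes [measurable]: "f \<in> borel_measurable M" "g \<in> borel_measurable M"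
    and disj: "\<And>x. f x = 0 \<or> g x = 0"
  shows "fun_modular (\<lambda>x. f x + g x) \<le> fun_modular f + fun_modular g"
proof -
  have "\<phi> \<bar>f x + g x\<bar> = \<phi> \<bar>f x\<bar> + \<phi> \<bar>g x\<bar>" for x
    using disj[of x] by auto
  then have "fun_modular (\<lambda>x. f x + g x) = lorentz (\<lambda>x. \<phi> \<bar>f x\<bar> + \<phi> \<bar>g x\<bar>)"
    by (subst fun_modular_eq_lorentz) auto
  also have "\<dots> \<le> lorentz (\<lambda>x. \<phi> \<bar>f x\<bar>) + lorentz (\<lambda>x. \<phi> \<bar>g x\<bar>)"
    by (rule lorentz_add) measurable
  finally show ?thesis by (simp add: fun_modular_eq_lorentz)
qed

text \<open>The superlevel set is \<open>A\<close> at all levels in [0, \<open>\<phi> u\<close>) and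
  empty from there on, so the layer cake integrand is constant on an interval of length
  \<open>\<phi> u\<close>.\<close>

lemma fun_modular_indicator:
  assumes [measurable]: "A \<in> sets M" and u: "0 \<le> u"
  shows "fun_modular (\<lambda>x. u * indicator A x) = ennreal (\<phi> u) * emeasure \<nu> {t. ennreal t < emeasure M A}"
proof -
  have A: "A \<subseteq> space M" using sets.sets_into_space[OF assms(1)] .
  have "fun_modular (\<lambda>x. u * indicator A x) = (\<integral>\<^sup>+ l \<in> {0..}. emeasure \<nu> {t. ennreal t <
      emeasure M {x \<in> space M. l < \<phi> \<bar>u * indicator A x\<bar>}} \<partial>lborel)"
    by (rule fun_modular_layer_cake) measurable
  also have "\<dots> = (\<integral>\<^sup>+ l. emeasure \<nu> {t. ennreal t < emeasure M A} * indicator {0..<\<phi> u} l \<partial>lborel)"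
  proof (rule nn_integral_cong)
    fix l :: real
    have eq: "{x \<in> space M. l < \<phi> \<bar>u * indicator A x\<bar>} = (if l < \<phi> u then A else {})" if "0 \<le> l"
      using u A that by (auto simp: indicator_def)
    then show "emeasure \<nu> {t. ennreal t < emeasure M {x \<in> space M. l < \<phi> \<bar>u * indicator A x\<bar>}}
        * indicator {0..} l = emeasure \<nu> {t. ennreal t < emeasure M A} * indicator {0..<\<phi> u} l"
      by (cases "0 \<le> l") (simp_all only: eq, auto simp: indicator_def)
  qed
  also have "\<dots> = ennreal (\<phi> u) * emeasure \<nu> {t. ennreal t < emeasure M A}"
    using phi_nonneg[OF u] by (subst nn_integral_cmult) (auto simp: mult.commute)
  finally show ?thesis .
qed

section \<open>Passage between classes and functions\<close>

definition ae_class :: "(real \<Rightarrow> real) \<Rightarrow> (real \<Rightarrow> real) set" where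
  "ae_class f = ae_rel \<gamma> `` {f}"

lemma ae_class_in_L0: "f \<in> borel_measurable M \<Longrightarrow> ae_class f \<in> L0 \<gamma>"
  by (auto simp: ae_class_def L0_def intro: quotientI)

lemma in_ae_class_iff: "g \<in> ae_class f \<longleftrightarrow> f \<in> borel_measurable M \<and> g \<in> borel_measurable M \<and> (AE x in M. f x = g x)"
  by (simp add: ae_class_def ae_rel_def)

lemma ae_class_eqI: "f \<in> borel_measurable M \<Longrightarrow> g \<in> borel_measurable M \<Longrightarrow> AE x in M. f x = g x \<Longrightarrow> ae_class f = ae_class g"
  unfolding ae_class_def by (intro equiv_class_eq[OF equiv_ae_rel]) (simp add: ae_rel_def)

lemma rep_ae_class:
  assumes "f \<in> borel_measurable M"
  shows "rep (ae_class f) \<in> borel_measurable M" "AE x in M. rep (ae_class f) x = f x"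
  using rep_in[OF ae_class_in_L0[OF assms]] by (auto simp: in_ae_class_iff elim: eventually_mono)

lemma L0_rep:
  assumes "X \<in> L0 \<gamma>"
  shows "rep X \<in> borel_measurable M" "ae_class (rep X) = X"
proof -
  obtain f where f: "f \<in> borel_measurable M" "X = ae_class f"
    using assms unfolding L0_def ae_class_def by (auto elim: quotientE)
  from rep_ae_class[OF f(1)] f show "rep X \<in> borel_measurable M" "ae_class (rep X) = X"
    using ae_class_eqI[of "rep (ae_class f)" f] by auto
qed

lemma modular_ae_class: "f \<in> borel_measurable M \<Longrightarrow> modular \<gamma> \<phi> w (ae_class f) = fun_modular f"
  unfolding modular_def fun_modular_def[symmetric]
  by (intro fun_modular_cong_AE) (auto dest: rep_ae_class elim: eventually_mono)

lemma L0_add_ae_class: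
  assumes "f \<in> borel_measurable M" "g \<in> borel_measurable M"
  shows "L0_add \<gamma> (ae_class f) (ae_class g) = ae_class (\<lambda>x. f x + g x)"
  unfolding L0_add_def ae_class_def[symmetric]
  using rep_ae_class[OF assms(1)] rep_ae_class[OF assms(2)] assms
  by (intro ae_class_eqI) (auto elim: eventually_elim2)

lemma L0_diff_ae_class:
  assumes "f \<in> borel_measurable M" "g \<in> borel_measurable M"
  shows "L0_diff \<gamma> (ae_class f) (ae_class g) = ae_class (\<lambda>x. f x - g x)"
  unfolding L0_diff_def ae_class_def[symmetric]
  using rep_ae_class[OF assms(1)] rep_ae_class[OF assms(2)] assms
  by (intro ae_class_eqI) (auto elim: eventually_elim2)

lemma L0_scale_ae_class:
  assumes "f \<in> borel_measurable M"
  shows "L0_scale \<gamma> c (ae_class f) = ae_class (\<lambda>x. c * f x)"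
  unfolding L0_scale_def ae_class_def[symmetric]
  using rep_ae_class[OF assms] assms
  by (intro ae_class_eqI) (auto elim: eventually_mono)

section \<open>The space and the Luxemburg norm on functions\<close>

definition olfun :: "(real \<Rightarrow> real) set" where
  "olfun = {f \<in> borel_measurable M. \<exists>c>0. fun_modular (\<lambda>x. c * f x) < \<infinity>}"

definition fun_norm :: "(real \<Rightarrow> real) \<Rightarrow> real" where
  "fun_norm f = Inf {e. 0 < e \<and> fun_modular (\<lambda>x. 1 / e * f x) \<le> 1}"

lemma olfun_measurable: "f \<in> olfun \<Longrightarrow> f \<in> borel_measurable M"
  by (simp add: olfun_def)

lemma orlicz_lorentz_eq: "orlicz_lorentz \<gamma> \<phi> w = ae_class ` olfun"
proof (intro set_eqI iffI)
  fix X assume "X \<in> orlicz_lorentz \<gamma> \<phi> w"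
  then have X: "X \<in> L0 \<gamma>" and "\<exists>c>0. modular \<gamma> \<phi> w (L0_scale \<gamma> c X) < \<infinity>"
    by (auto simp: orlicz_lorentz_def)
  moreover note f = L0_rep[OF X]
  moreover have "modular \<gamma> \<phi> w (L0_scale \<gamma> c X) = fun_modular (\<lambda>x. c * rep X x)" for c
    using L0_scale_ae_class[OF f(1), of c] modular_ae_class[of "\<lambda>x. c * rep X x"] f by simp
  ultimately have "rep X \<in> olfun" by (auto simp: olfun_def)
  with f(2) show "X \<in> ae_class ` olfun" by force
next
  fix X assume "X \<in> ae_class ` olfun"
  then show "X \<in> orlicz_lorentz \<gamma> \<phi> w"
    by (auto simp: orlicz_lorentz_def olfun_def ae_class_in_L0 L0_scale_ae_class modular_ae_class)
qed

lemma lux_norm_ae_class: "f \<in> borel_measurable M \<Longrightarrow> lux_norm \<gamma> \<phi> w (ae_class f) = fun_norm f"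
  by (simp add: lux_norm_def fun_norm_def L0_scale_ae_class modular_ae_class)

lemma olfunI: "f \<in> borel_measurable M \<Longrightarrow> fun_modular f < \<infinity> \<Longrightarrow> f \<in> olfun"
  unfolding olfun_def by (auto intro!: exI[of _ 1])

lemma olfun_scale:
  assumes f: "f \<in> olfun"
  shows "(\<lambda>x. c * f x) \<in> olfun"
proof -
  obtain d where d: "0 < d" "fun_modular (\<lambda>x. d * f x) < \<infinity>" using f by (auto simp: olfun_def)
  note [measurable] = olfun_measurable[OF f]
  \<comment> \<open>The added 1 covers \<open>c = 0\<close> and still gives
    \<open>?k * \<bar>c\<bar> \<le> d\<close>.\<close>
  let ?k = "d / (\<bar>c\<bar> + 1)"
  have "fun_modular (\<lambda>x. ?k * (c * f x)) \<le> fun_modular (\<lambda>x. d * f x)"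
  proof (rule fun_modular_mono)
    have "\<bar>?k * (c * f x)\<bar> \<le> \<bar>d * f x\<bar>" for x
    proof -
      have "\<bar>?k * (c * f x)\<bar> = \<bar>d * f x\<bar> * (\<bar>c\<bar> / (\<bar>c\<bar> + 1))"
        using d by (simp add: abs_mult)
      also have "\<dots> \<le> \<bar>d * f x\<bar> * 1"
        by (intro mult_left_mono) auto
      finally show ?thesis by simp
    qed
    then show "AE x in M. \<bar>?k * (c * f x)\<bar> \<le> \<bar>d * f x\<bar>" by simp
  qed measurable
  also note d(2)
  finally show ?thesis
    using d unfolding olfun_def by (auto intro!: exI[of _ ?k] divide_pos_pos)
qed

lemma olfun_add:
  assumes f: "f \<in> olfun" and g: "g \<in> olfun"
  shows "(\<lambda>x. f x + g x) \<in> olfun"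
proof -
  obtain c d where cd: "0 < c" "fun_modular (\<lambda>x. c * f x) < \<infinity>" "0 < d" "fun_modular (\<lambda>x. d * g x) < \<infinity>"
    using f g by (auto simp: olfun_def)
  note [measurable] = olfun_measurable[OF f] olfun_measurable[OF g]
  define k where "k = min c d"
  have k: "0 < k" "k \<le> c" "k \<le> d" using cd by (auto simp: k_def)
  \<comment> \<open>\<open>k / 2 * (f + g)\<close> is the midpoint of \<open>k * f\<close> and
    \<open>k * g\<close>, both of finite modular because \<open>k\<close> is at most
    \<open>c\<close> and \<open>d\<close>.\<close>
  have "fun_modular (\<lambda>x. 1/2 * (k * f x) + (1 - 1/2) * (k * g x))
      \<le> ennreal (1/2) * fun_modular (\<lambda>x. k * f x) + ennreal (1 - 1/2) * fun_modular (\<lambda>x. k * g x)"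
    by (rule fun_modular_convex) auto
  also have "\<dots> \<le> ennreal (1/2) * fun_modular (\<lambda>x. c * f x) + ennreal (1 - 1/2) * fun_modular (\<lambda>x. d * g x)"
    using k by (intro add_mono mult_left_mono fun_modular_mono AE_I2) (auto simp: abs_mult intro: mult_right_mono)
  also have "\<dots> < \<infinity>" using cd ennreal_less_top[of "1/2"] by (auto simp: ennreal_mult_less_top)
  also have "(\<lambda>x. 1/2 * (k * f x) + (1 - 1/2) * (k * g x)) = (\<lambda>x. k / 2 * (f x + g x))"
    by (auto simp: algebra_simps)
  finally show ?thesis using k unfolding olfun_def by (auto intro!: exI[of _ "k / 2"])
qed

lemma fun_modular_divide_mono:
  assumes "f \<in> borel_measurable M" "0 < d" "d \<le> e"
  shows "fun_modular (\<lambda>x. 1 / e * f x) \<le> fun_modular (\<lambda>x. 1 / d * f x)"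
proof (rule fun_modular_mono)
  have "\<bar>1 / e * f x\<bar> \<le> \<bar>1 / d * f x\<bar>" for x
    using assms by (simp add: abs_mult divide_left_mono)
  then show "AE x in M. \<bar>1 / e * f x\<bar> \<le> \<bar>1 / d * f x\<bar>" by simp
qed (use assms in auto)

lemma fun_norm_set_nonempty:
  assumes f: "f \<in> olfun"
  shows "{e. 0 < e \<and> fun_modular (\<lambda>x. 1 / e * f x) \<le> 1} \<noteq> {}"
proof -
  note [measurable] = olfun_measurable[OF f]
  obtain c where c: "0 < c" "fun_modular (\<lambda>x. c * f x) < \<infinity>" using f by (auto simp: olfun_def)
  then obtain r where r: "fun_modular (\<lambda>x. c * f x) = ennreal r" "0 \<le> r"
    by (cases "fun_modular (\<lambda>x. c * f x)") auto
  \<comment> \<open>The modular shrinks at least linearly, so a factor at most \<open>1 / r\<close>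
    brings it down to 1; the added 1 makes \<open>\<theta> \<le> 1\<close> and handles
    \<open>r = 0\<close>.\<close>
  define \<theta> where "\<theta> = 1 / (r + 1)"
  have th: "0 < \<theta>" "\<theta> \<le> 1" "\<theta> * r \<le> 1" using r by (auto simp: \<theta>_def)
  have "fun_modular (\<lambda>x. \<theta> * (c * f x)) \<le> ennreal \<theta> * ennreal r"
    unfolding r(1)[symmetric] using th by (intro fun_modular_shrink) auto
  also have "\<dots> = ennreal (\<theta> * r)"
    using th by (simp add: ennreal_mult' r)
  also have "\<dots> \<le> 1" using th by simp
  finally have "fun_modular (\<lambda>x. 1 / (1 / (\<theta> * c)) * f x) \<le> 1" by (simp add: mult.assoc)
  moreover have "0 < 1 / (\<theta> * c)" using th c by simp
  ultimately show ?thesis by blast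
qed

lemma fun_norm_le:
  assumes "0 < e" "fun_modular (\<lambda>x. 1 / e * f x) \<le> 1"
  shows "fun_norm f \<le> e"
  unfolding fun_norm_def using assms by (intro cInf_lower) (auto intro: bdd_belowI[of _ 0])

lemma fun_norm_nonneg: "f \<in> olfun \<Longrightarrow> 0 \<le> fun_norm f"
  unfolding fun_norm_def by (intro cInf_greatest fun_norm_set_nonempty) auto

text \<open>The strict inequality supplies an admissible \<open>d < e\<close>, so attainment of the
  infimum is not at issue.\<close>

lemma fun_modular_le_1:
  assumes f: "f \<in> olfun" and "fun_norm f < e"
  shows "fun_modular (\<lambda>x. 1 / e * f x) \<le> 1"
proof -
  obtain d where "0 < d" "fun_modular (\<lambda>x. 1 / d * f x) \<le> 1" "d < e"
    using cInf_lessD[OF fun_norm_set_nonempty[OF f], of e] assms by (auto simp: fun_norm_def)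
  with fun_modular_divide_mono[OF olfun_measurable[OF f], of d e] show ?thesis by auto
qed

lemma fun_norm_ge:
  assumes "f \<in> olfun" "1 < fun_modular (\<lambda>x. 1 / e * f x)"
  shows "e \<le> fun_norm f"
  using fun_modular_le_1[OF assms(1), of e] assms(2) by (meson leD leI)

text \<open>With \<open>d = 1 + e / 2\<close>, the function \<open>(f - g) / (2 + e)\<close> is the
  midpoint of \<open>f / d\<close> and \<open>- g / d\<close>, which have modular at most 1;
  convexity of the modular does the rest.\<close>

lemma fun_norm_diff_le:
  assumes f: "f \<in> olfun" "fun_norm f \<le> 1" and g: "g \<in> olfun" "fun_norm g \<le> 1"
  shows "fun_norm (\<lambda>x. f x - g x) \<le> 2"
proof (rule field_le_epsilon)
  fix e :: real assume e: "0 < e"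
  note [measurable] = olfun_measurable[OF f(1)] olfun_measurable[OF g(1)]
  define d where "d = 1 + e / 2"
  have d: "1 < d" using e by (simp add: d_def)
  let ?f = "\<lambda>x. 1 / d * f x" and ?g = "\<lambda>x. 1 / d * g x"
  have "fun_modular (\<lambda>x. 1 / (2 + e) * (f x - g x)) = fun_modular (\<lambda>x. 1/2 * ?f x + (1 - 1/2) * (- ?g x))"
  proof (rule arg_cong[where f=fun_modular], rule ext)
    fix x
    have "2 + e = 2 * d" by (simp add: d_def)
    then show "1 / (2 + e) * (f x - g x) = 1/2 * ?f x + (1 - 1/2) * (- ?g x)"
      using d by (simp add: field_simps)
  qed
  also have "\<dots> \<le> ennreal (1/2) * fun_modular ?f + ennreal (1 - 1/2) * fun_modular (\<lambda>x. - ?g x)"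
    by (rule fun_modular_convex) auto
  also have "fun_modular (\<lambda>x. - ?g x) = fun_modular ?g"
    by (intro antisym fun_modular_mono) auto
  also have "ennreal (1/2) * fun_modular ?f + ennreal (1 - 1/2) * fun_modular ?g
      \<le> ennreal (1/2) * 1 + ennreal (1 - 1/2) * 1"
    using d f g by (intro add_mono mult_left_mono fun_modular_le_1) auto
  also have "\<dots> = 1"
    by (simp only: mult_1_right, subst ennreal_plus[symmetric]) auto
  finally show "fun_norm (\<lambda>x. f x - g x) \<le> 2 + e"
    using e by (intro fun_norm_le) auto
qed

lemma unit_ball_eq: "unit_ball \<gamma> \<phi> w = ae_class ` {f \<in> olfun. fun_norm f \<le> 1}"
  unfolding unit_ball_def orlicz_lorentz_eq
  by (auto simp: lux_norm_ae_class olfun_measurable)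

subsection \<open>The weighted measure and the growth of the Orlicz function\<close>

text \<open>The primitive of the weight, with an extended argument so that values of distribution
  functions can be inserted directly.\<close>

definition V :: "ennreal \<Rightarrow> ennreal" where
  "V a = emeasure \<nu> {t. ennreal t < a}"

lemma V_eq: "V a = (\<integral>\<^sup>+ t \<in> {t. ennreal t < a}. wgt t \<partial>lborel)"
  unfolding V_def \<nu>_def by (rule emeasure_density) measurable

lemma V_finite:
  assumes "T \<in> ivl \<gamma>"
  shows "V (ennreal T) < \<infinity>"
proof -
  have "V (ennreal T) \<le> W w (ereal T)"
    unfolding V_eq W_def nn_integral_completion
  proof (rule nn_integral_mono)
    fix s
    show "wgt s * indicator {t. ennreal t < ennreal T} s \<le> ennreal (w s) * indicator (ivl (ereal T)) s"
      by (auto simp: wgt_def indicator_def ivl_def ennreal_less_iff)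
  qed
  also have "\<dots> < \<infinity>"
    using assms weight by (auto simp: weight_function_def)
  finally show ?thesis .
qed

text \<open>On (0, T) the decreasing weight is at least \<open>w T > 0\<close>.\<close>

lemma V_pos:
  assumes T: "T \<in> ivl \<gamma>" "0 < T"
  shows "0 < V (ennreal T)"
proof -
  have "0 < ennreal (w T) * ennreal T"
    using T w_pos[of T] by (simp add: ennreal_zero_less_mult_iff)
  also have "\<dots> = (\<integral>\<^sup>+ s. ennreal (w T) * indicator {0<..<T} s \<partial>lborel)"
    using T by (subst nn_integral_cmult) auto
  also have "\<dots> \<le> V (ennreal T)"
    unfolding V_eq
  proof (rule nn_integral_mono)
    fix s
    show "ennreal (w T) * indicator {0<..<T} s \<le> wgt s * indicator {t. ennreal t < ennreal T} s"
    proof (cases "s \<in> {0<..<T}")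
      case True
      then have "s \<in> ivl \<gamma> - {0}" using ivl_down[OF T(1), of s] by auto
      with True T w_antimono[of s T] show ?thesis
        by (auto simp: wgt_def ennreal_less_iff intro: ennreal_leI)
    qed simp
  qed
  finally show ?thesis .
qed

text \<open>The infinite total mass of \<open>\<nu>\<close> is the supremum of the masses of the
  sets \<open>{t. ennreal t < ennreal (Suc n)}\<close>, by continuity from below.\<close>

lemma V_unbounded:
  assumes inf: "\<gamma> = \<infinity>" and W: "W w \<infinity> = \<infinity>"
  shows "\<exists>T>0. ennreal v \<le> V (ennreal T)"
proof -
  have "emeasure \<nu> UNIV = (\<integral>\<^sup>+ t. wgt t \<partial>lborel)"
    unfolding \<nu>_def by (subst emeasure_density) auto
  also have "\<dots> = W w \<gamma>"
    unfolding W_def nn_integral_completion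
  proof (rule nn_integral_cong_AE)
    show "AE t in lborel. wgt t = ennreal (w t) * indicator (ivl \<gamma>) t"
      using AE_lborel_singleton[of 0]
      by eventually_elim (auto simp: wgt_def indicator_def)
  qed
  finally have top: "emeasure \<nu> UNIV = \<infinity>" using W inf by simp
  have "(SUP n::nat. V (ennreal (Suc n))) = emeasure \<nu> (\<Union>n::nat. {t. ennreal t < ennreal (Suc n)})"
    unfolding V_def
  proof (rule SUP_emeasure_incseq)
    show "range (\<lambda>n::nat. {t. ennreal t < ennreal (Suc n)}) \<subseteq> sets \<nu>"
      by (rule image_subsetI) (simp, measurable)
    show "incseq (\<lambda>n::nat. {t. ennreal t < ennreal (Suc n)})"
      by (auto simp: incseq_def intro: less_le_trans ennreal_leI)
  qed
  also have "(\<Union>n::nat. {t. ennreal t < ennreal (Suc n)}) = UNIV"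
  proof (rule UNIV_eq_I[symmetric])
    fix t :: real
    obtain n :: nat where "\<bar>t\<bar> < n" using reals_Archimedean2 by blast
    then have "ennreal t < ennreal (Suc n)" by (intro ennreal_lessI) auto
    then show "t \<in> (\<Union>n::nat. {t. ennreal t < ennreal (Suc n)})" by blast
  qed
  finally have "ennreal v < (SUP n::nat. V (ennreal (Suc n)))"
    unfolding top by (simp only: infinity_ennreal_def ennreal_less_top)
  then obtain n :: nat where "ennreal v < V (ennreal (Suc n))" by (auto simp: less_SUP_iff)
  then show ?thesis by (intro exI[of _ "real (Suc n)"]) (auto intro: less_imp_le)
qed

text \<open>\<open>V\<close> is an indefinite integral of a function integrable on [0, T], hence
  continuous there even if the weight blows up at 0, and it starts from 0.\<close>

lemma V_intermediate:
  assumes T: "T \<in> ivl \<gamma>" and v: "0 < v" "ennreal v \<le> V (ennreal T)"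
  shows "\<exists>t. 0 < t \<and> t \<le> T \<and> V (ennreal t) = ennreal v"
proof -
  \<comment> \<open>\<open>wgt\<close> is finite everywhere, so \<open>enn2real\<close> loses
    nothing and the gauge integral becomes available.\<close>
  define g where "g s = enn2real (wgt s)" for s
  have [measurable]: "g \<in> borel_measurable borel"
    unfolding g_def by measurable
  have wgt_fin: "wgt s < \<infinity>" for s
    by (auto simp: wgt_def indicator_def)
  have has: "(g has_integral enn2real (V (ennreal t))) {0..t}" if t: "0 \<le> t" "t \<le> T" for t
  proof -
    have fin: "V (ennreal t) < \<infinity>" using ivl_down[OF T t] by (rule V_finite)
    have "(\<integral>\<^sup>+ s. ennreal (if s \<in> {0..t} then g s else 0) \<partial>lborel) = V (ennreal t)"
      unfolding V_eq
    proof (rule nn_integral_cong_AE)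
      show "AE s in lborel. ennreal (if s \<in> {0..t} then g s else 0)
          = wgt s * indicator {s. ennreal s < ennreal t} s"
        using AE_lborel_singleton[of t]
      proof eventually_elim
        case (elim s)
        have "wgt s = 0" if "s < 0"
          using that by (auto simp: wgt_def indicator_def ivl_def)
        then show ?case
          using elim wgt_fin[of s] t
          by (cases "s < 0") (auto simp: g_def indicator_def ennreal_less_iff)
      qed
    qed
    also have "\<dots> = ennreal (enn2real (V (ennreal t)))"
      using fin by simp
    finally have "((\<lambda>s. if s \<in> {0..t} then g s else 0) has_integral enn2real (V (ennreal t))) UNIV"
      by (intro nn_integral_has_integral) (measurable, auto simp: g_def)
    then show ?thesis by (subst (asm) has_integral_restrict_UNIV)
  qed
  have T0: "0 \<le> T" using T by (simp add: ivl_def)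
  have "continuous_on {0..T} (\<lambda>t. integral {0..t} g)"
    using has[OF T0] by (intro indefinite_integral_continuous_1) (auto simp: integrable_on_def)
  then have "continuous_on {0..T} (\<lambda>t. enn2real (V (ennreal t)))"
    by (rule continuous_on_eq) (use has in \<open>auto simp: integral_unique\<close>)
  moreover have "enn2real (V (ennreal 0)) = 0"
    by (simp add: V_def)
  moreover have "v \<le> enn2real (V (ennreal T))"
    using v V_finite[OF T] enn2real_mono[OF v(2)] by simp
  ultimately obtain t where t: "0 \<le> t" "t \<le> T" "enn2real (V (ennreal t)) = v"
    using IVT'[of "\<lambda>t. enn2real (V (ennreal t))" 0 v T] v T0 by auto
  have "t \<noteq> 0"
    using t v \<open>enn2real (V (ennreal 0)) = 0\<close> by auto
  moreover have "V (ennreal t) = ennreal v"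
    using V_finite[OF ivl_down[OF T t(1,2)]] t(3) by auto
  ultimately show ?thesis using t by (intro exI[of _ t]) auto
qed

section \<open>Consequences of failing doubling conditions\<close>

text \<open>Iterating the bound for the factor \<open>1 + \<eta>\<close> until its power exceeds 2
  gives doubling. Hence without doubling, \<open>\<phi>\<close> has arbitrarily large relative jumps
  under factors arbitrarily close to 1.\<close>

lemma phi_doubling:
  assumes "0 < \<eta>" and step: "\<And>u. u0 \<le> u \<Longrightarrow> \<phi> ((1 + \<eta>) * u) \<le> K * \<phi> u" and u0: "0 \<le> u0"
  shows "\<exists>K'>0. \<forall>u\<ge>u0. \<phi> (2 * u) \<le> K' * \<phi> u"
proof -
  \<comment> \<open>The sign of \<open>K\<close> is not fixed; \<open>L\<close> is positive, so the
    estimates can be multiplied together.\<close>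
  define L where "L = max 1 K"
  have iter: "\<phi> ((1 + \<eta>) ^ n * u) \<le> L ^ n * \<phi> u" if u: "u0 \<le> u" for n u
  proof (induction n)
    case (Suc n)
    have "1 * u \<le> (1 + \<eta>) ^ n * u"
      using assms u by (intro mult_right_mono one_le_power) auto
    then have ge: "u0 \<le> (1 + \<eta>) ^ n * u" using u by simp
    have "\<phi> ((1 + \<eta>) ^ Suc n * u) \<le> K * \<phi> ((1 + \<eta>) ^ n * u)"
      using step[OF ge] by (simp add: mult.assoc)
    also have "\<dots> \<le> L * \<phi> ((1 + \<eta>) ^ n * u)"
      using ge u0 by (intro mult_right_mono phi_nonneg) (auto simp: L_def)
    also have "\<dots> \<le> L * (L ^ n * \<phi> u)"
      using Suc by (intro mult_left_mono) (auto simp: L_def)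
    finally show ?case by (simp add: mult.assoc)
  qed simp
  obtain n where n: "2 < (1 + \<eta>) ^ n"
    using real_arch_pow[of "1 + \<eta>" 2] assms by auto
  have "\<phi> (2 * u) \<le> L ^ n * \<phi> u" if u: "u0 \<le> u" for u
  proof -
    have "\<phi> (2 * u) \<le> \<phi> ((1 + \<eta>) ^ n * u)"
      using u u0 n by (intro phi_mono mult_right_mono) auto
    with iter[OF u, of n] show ?thesis by simp
  qed
  moreover have "0 < L ^ n" by (simp add: L_def)
  ultimately show ?thesis by blast
qed

text \<open>The contrapositive of \<open>phi_doubling\<close> with threshold 0. At
  \<open>u = 0\<close> both sides vanish, so the violating point is positive.\<close>

lemma phi_jump:
  assumes "0 < \<eta>" "0 \<le> K" and nd: "\<not> Delta2 \<phi>"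
  shows "\<exists>u>0. K * \<phi> u < \<phi> ((1 + \<eta>) * u)"
proof (rule ccontr)
  assume *: "\<not> ?thesis"
  have "\<phi> ((1 + \<eta>) * u) \<le> K * \<phi> u" if "0 \<le> u" for u
  proof (cases "u = 0")
    case False
    with that have "0 < u" by simp
    with * show ?thesis by (meson leI)
  qed simp
  then show False
    using phi_doubling[of \<eta> 0 K] assms(1) nd by (auto simp: Delta2_def)
qed

lemma phi_jump_infinity:
  assumes "0 < \<eta>" and nd: "\<not> Delta2_infinity \<phi>" and "0 \<le> u0"
  shows "\<exists>u\<ge>u0. K * \<phi> u < \<phi> ((1 + \<eta>) * u)"
proof (rule ccontr)
  assume *: "\<not> ?thesis"
  have "\<phi> ((1 + \<eta>) * u) \<le> K * \<phi> u" if "u0 \<le> u" for u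
    using * that by (auto simp: not_less)
  then show False
    using phi_doubling[of \<eta> u0 K] assms nd by (auto simp: Delta2_infinity_def)
qed

subsection \<open>Weak convergence\<close>

lemma dual_add:
  "F \<in> dual \<gamma> \<phi> w \<Longrightarrow> f \<in> olfun \<Longrightarrow> g \<in> olfun \<Longrightarrow> F (ae_class (\<lambda>x. f x + g x)) = F (ae_class f) + F (ae_class g)"
  using L0_add_ae_class[OF olfun_measurable olfun_measurable, of f g, symmetric] by (auto simp: dual_def orlicz_lorentz_eq)

lemma dual_scale:
  "F \<in> dual \<gamma> \<phi> w \<Longrightarrow> f \<in> olfun \<Longrightarrow> F (ae_class (\<lambda>x. c * f x)) = c * F (ae_class f)"
  using L0_scale_ae_class[OF olfun_measurable, of f c, symmetric] by (auto simp: dual_def orlicz_lorentz_eq)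

lemma dual_diff:
  assumes "F \<in> dual \<gamma> \<phi> w" "f \<in> olfun" "g \<in> olfun"
  shows "F (ae_class (\<lambda>x. f x - g x)) = F (ae_class f) - F (ae_class g)"
  using dual_add[OF assms(1,2) olfun_scale[OF assms(3), of "-1"]] dual_scale[OF assms(1,3), of "-1"] by simp

text \<open>The bound is stated on the modular ball, since modulars of signed sums are what can be
  estimated directly; modular at most 1 forces norm at most 1.\<close>

lemma dual_bounded:
  assumes F: "F \<in> dual \<gamma> \<phi> w"
  obtains C where "\<And>f. f \<in> olfun \<Longrightarrow> fun_modular f \<le> 1 \<Longrightarrow> \<bar>F (ae_class f)\<bar> \<le> C"
proof -
  obtain C where C: "\<And>X. X \<in> orlicz_lorentz \<gamma> \<phi> w \<Longrightarrow> \<bar>F X\<bar> \<le> C * lux_norm \<gamma> \<phi> w X"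
    using F unfolding dual_def by blast
  have "\<bar>F (ae_class f)\<bar> \<le> \<bar>C\<bar>" if f: "f \<in> olfun" "fun_modular f \<le> 1" for f
  proof -
    have "\<bar>F (ae_class f)\<bar> \<le> C * fun_norm f"
      using C[of "ae_class f"] f by (simp add: orlicz_lorentz_eq lux_norm_ae_class olfun_measurable)
    also have "\<dots> \<le> \<bar>C\<bar> * fun_norm f"
      using fun_norm_nonneg[OF f(1)] by (intro mult_right_mono) auto
    also have "\<dots> \<le> \<bar>C\<bar> * 1"
      using fun_norm_le[of 1 f] f(2) by (intro mult_left_mono) auto
    finally show ?thesis by simp
  qed
  with that show thesis by blast
qed

lemma zero_olfun: "(\<lambda>x. 0) \<in> olfun"
  using fun_modular_indicator[of "{}" 0] by (intro olfunI) auto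

lemma sum_olfun:
  fixes n :: nat
  assumes "\<And>k. h k \<in> olfun"
  shows "(\<lambda>x. \<Sum>k<n. c k * h k x) \<in> olfun"
proof (induction n)
  case (Suc n)
  then show ?case using olfun_add[OF Suc olfun_scale[OF assms]] by simp
qed (simp add: zero_olfun)

lemma dual_sum:
  fixes n :: nat
  assumes F: "F \<in> dual \<gamma> \<phi> w" and h: "\<And>k. h k \<in> olfun"
  shows "F (ae_class (\<lambda>x. \<Sum>k<n. c k * h k x)) = (\<Sum>k<n. c k * F (ae_class (h k)))"
proof (induction n)
  case 0
  show ?case using dual_scale[OF F zero_olfun, of 0] by simp
next
  case (Suc n)
  have "F (ae_class (\<lambda>x. (\<Sum>k<n. c k * h k x) + c n * h n x))
      = F (ae_class (\<lambda>x. \<Sum>k<n. c k * h k x)) + F (ae_class (\<lambda>x. c n * h n x))"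
    by (intro dual_add F sum_olfun olfun_scale h)
  then show ?case using Suc dual_scale[OF F h] by simp
qed

text \<open>Choosing the signs of the values \<open>F (h k)\<close> bounds \<open>\<Sum>\<bar>F (h k)\<bar>\<close>.\<close>

lemma weakly_null:
  assumes F: "F \<in> dual \<gamma> \<phi> w" and h: "\<And>k. h k \<in> olfun"
    and signs: "\<And>n c. (\<And>k. \<bar>c k\<bar> \<le> 1) \<Longrightarrow> fun_modular (\<lambda>x. \<Sum>k<n. c k * h k x) \<le> 1"
  shows "(\<lambda>k. F (ae_class (h k))) \<longlonglongrightarrow> 0"
proof -
  obtain C where C: "\<And>f. f \<in> olfun \<Longrightarrow> fun_modular f \<le> 1 \<Longrightarrow> \<bar>F (ae_class f)\<bar> \<le> C"
    using dual_bounded[OF F] by blast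
  have "(\<Sum>k<n. \<bar>F (ae_class (h k))\<bar>) \<le> C" for n
  proof -
    let ?c = "\<lambda>k. sgn (F (ae_class (h k)))"
    have "(\<Sum>k<n. \<bar>F (ae_class (h k))\<bar>) = F (ae_class (\<lambda>x. \<Sum>k<n. ?c k * h k x))"
      unfolding dual_sum[OF F h] by (simp add: abs_sgn mult.commute)
    also have "\<dots> \<le> C"
    proof -
      have "fun_modular (\<lambda>x. \<Sum>k<n. ?c k * h k x) \<le> 1"
        by (rule signs) (auto simp: sgn_if)
      from C[OF sum_olfun[OF h] this] show ?thesis by simp
    qed
    finally show ?thesis .
  qed
  then have "summable (\<lambda>k. \<bar>F (ae_class (h k))\<bar>)"
    by (intro summableI_nonneg_bounded[where x=C]) auto
  then show ?thesis
    using summable_LIMSEQ_zero tendsto_rabs_zero_iff by blast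
qed

text \<open>Convergence under each functional puts the sequence eventually into every subbasic
  neighbourhood. Induction over the generation of the topology carries this through binary
  intersections and unions.\<close>

lemma eventually_in_weakly_open:
  assumes U: "openin (weak_topology \<gamma> \<phi> w) U" and f: "ae_class f \<in> U"
    and y: "\<And>k. y k \<in> olfun" "\<And>F. F \<in> dual \<gamma> \<phi> w \<Longrightarrow> (\<lambda>k. F (ae_class (y k))) \<longlonglongrightarrow> F (ae_class f)"
  shows "eventually (\<lambda>k::nat. ae_class (y k) \<in> U) sequentially"
proof -
  have "generate_topology_on {{X \<in> orlicz_lorentz \<gamma> \<phi> w. F X \<in> V} |F V. F \<in> dual \<gamma> \<phi> w \<and> open V} U"
    using U unfolding weak_topology_def by (rule openin_topology_generated_by)
  then show ?thesis using f
  proof induction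
    case (Int a b)
    then show ?case by (auto intro: eventually_conj)
  next
    case (UN K)
    then obtain k where k: "k \<in> K" "ae_class f \<in> k" by blast
    from UN(2)[OF this] show ?case
      by eventually_elim (use k(1) in blast)
  next
    case (Basis s)
    then obtain F V where F: "F \<in> dual \<gamma> \<phi> w" "open V"
      and s: "s = {X \<in> orlicz_lorentz \<gamma> \<phi> w. F X \<in> V}" by blast
    have "eventually (\<lambda>k. F (ae_class (y k)) \<in> V) sequentially"
      using y(2)[OF F(1)] F(2) Basis(2) s by (auto intro: topological_tendstoD)
    then show ?case
      by eventually_elim (use y(1) in \<open>auto simp: s orlicz_lorentz_eq\<close>)
  qed simp
qed

end

section \<open>Failure of the growth condition\<close>

locale orlicz_lorentz_space_not_Delta2 = orlicz_lorentz_space +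
  assumes W_infinity: "\<gamma> = \<infinity> \<Longrightarrow> W w \<infinity> = \<infinity>"
    and not_Delta2: "(\<gamma> = \<infinity> \<and> \<not> Delta2 \<phi>) \<or> (\<gamma> < \<infinity> \<and> \<not> Delta2_infinity \<phi>)"
begin

text \<open>First \<open>u\<close> is chosen so that the factor \<open>1 + \<eta>\<close> multiplies
  \<open>\<phi> u\<close> by more than \<open>1 / \<epsilon>\<close>; then \<open>t\<close> is
  chosen with \<open>\<phi> u * V t = \<epsilon>\<close>. The second choice needs
  \<open>\<epsilon> / \<phi> u\<close> in the range of \<open>V\<close>: on the infinite interval
  \<open>V\<close> is unbounded, on a finite one \<open>u\<close> has to be large, which is why
  failure of doubling near infinity is used there.\<close>

lemma bump_exists:
  assumes "0 < \<eta>" "0 < \<epsilon>" and cap: "\<gamma> < \<infinity> \<Longrightarrow> cap \<in> ivl \<gamma> \<and> 0 < cap"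
  shows "\<exists>u t. 0 < u \<and> 0 < t \<and> ereal t < \<gamma> \<and> (\<gamma> < \<infinity> \<longrightarrow> t \<le> cap) \<and>
     ennreal (\<phi> u) * V (ennreal t) \<le> ennreal \<epsilon> \<and> 1 < ennreal (\<phi> ((1 + \<eta>) * u)) * V (ennreal t)"
proof -
  obtain u T where u: "0 < u" "1 / \<epsilon> * \<phi> u < \<phi> ((1 + \<eta>) * u)"
    and T: "T \<in> ivl \<gamma>" "\<gamma> < \<infinity> \<longrightarrow> T \<le> cap" "ennreal (\<epsilon> / \<phi> u) \<le> V (ennreal T)"
  proof (cases "\<gamma> = \<infinity>")
    case True
    with not_Delta2 have "\<not> Delta2 \<phi>" by simp
    then obtain u where u: "0 < u" "1 / \<epsilon> * \<phi> u < \<phi> ((1 + \<eta>) * u)"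
      using phi_jump[of \<eta> "1 / \<epsilon>"] assms by auto
    moreover obtain T where "0 < T" "ennreal (\<epsilon> / \<phi> u) \<le> V (ennreal T)"
      using V_unbounded[OF True W_infinity[OF True]] by blast
    ultimately show thesis using that[of u T] True by (simp add: ivl_def)
  next
    case False
    with not_Delta2 have fin: "\<gamma> < \<infinity>" and nd: "\<not> Delta2_infinity \<phi>" by auto
    note cap = cap[OF fin]
    obtain c where c: "V (ennreal cap) = ennreal c" "0 < c"
      using V_finite[of cap] V_pos[of cap] cap by (cases "V (ennreal cap)") auto
    note p1 = phi_pos[of 1]
    \<comment> \<open>Beyond 1 one has \<open>\<phi> u \<ge> u * \<phi> 1\<close>, so this threshold
      ensures \<open>\<epsilon> \<le> c * \<phi> u\<close>.\<close>
    define u0 where "u0 = max 1 (\<epsilon> / (c * \<phi> 1))"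
    obtain u where u: "u0 \<le> u" "1 / \<epsilon> * \<phi> u < \<phi> ((1 + \<eta>) * u)"
      using phi_jump_infinity[OF assms(1) nd, of u0 "1 / \<epsilon>"] le_max_iff_disj[of 0 1]
      unfolding u0_def by (metis zero_le_one)
    then have u1: "1 \<le> u" "\<epsilon> / (c * \<phi> 1) \<le> u" by (auto simp: u0_def)
    then have "\<epsilon> \<le> c * (u * \<phi> 1)" using c p1 by (simp add: field_simps)
    also have "\<dots> \<le> c * \<phi> u" using phi_at_least[OF u1(1)] c by simp
    finally have "\<epsilon> / \<phi> u \<le> c" using phi_pos[of u] u1 by (simp add: field_simps)
    then have "ennreal (\<epsilon> / \<phi> u) \<le> V (ennreal cap)" using c by (simp add: ennreal_leI)
    then show thesis using that[of u cap] u u1 cap by simp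
  qed
  have pu: "0 < \<phi> u" using u by (intro phi_pos)
  obtain t where t: "0 < t" "t \<le> T" "V (ennreal t) = ennreal (\<epsilon> / \<phi> u)"
    using V_intermediate[OF T(1) _ T(3)] pu assms by auto
  have "ereal t < \<gamma>" using ivl_down[OF T(1), of t] t by (simp add: ivl_def)
  moreover have "ennreal (\<phi> u) * V (ennreal t) = ennreal \<epsilon>"
    using pu assms t by (simp flip: ennreal_mult)
  moreover have "1 < ennreal (\<phi> ((1 + \<eta>) * u)) * V (ennreal t)"
  proof -
    have "1 < \<phi> ((1 + \<eta>) * u) * (\<epsilon> / \<phi> u)"
      using u pu assms by (simp add: field_simps)
    then have "ennreal 1 < ennreal (\<phi> ((1 + \<eta>) * u) * (\<epsilon> / \<phi> u))"
      by (intro ennreal_lessI) auto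
    also have "\<dots> = ennreal (\<phi> ((1 + \<eta>) * u)) * V (ennreal t)"
      unfolding t(3) using pu assms u by (intro ennreal_mult phi_nonneg) auto
    finally show ?thesis by simp
  qed
  ultimately show ?thesis using u t T by (intro exI[of _ u] exI[of _ t]) auto
qed

text \<open>By \<open>fun_modular_indicator\<close> only the length of the supporting set matters,
  so the lengths from \<open>bump_exists\<close> are laid out as consecutive intervals starting at
  0.\<close>

lemma disjoint_bumps:
  assumes "0 < \<eta>" "0 < \<epsilon>"
  shows "\<exists>(A :: nat \<Rightarrow> real set) u. (\<forall>k. A k \<in> sets M) \<and> disjoint_family A \<and> (\<forall>k. 0 < u k) \<and>
    (\<forall>k. fun_modular (\<lambda>x. u k * indicator (A k) x) \<le> ennreal (\<epsilon> * (1/2) ^ Suc k)) \<and>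
    (\<forall>k. 1 < fun_modular (\<lambda>x. (1 + \<eta>) * u k * indicator (A k) x))"
proof -
  \<comment> \<open>For finite \<open>\<gamma>\<close> the caps are \<open>g / 2 ^ (k + 1)\<close>
    with sum \<open>g\<close>, so all intervals fit into \<open>ivl \<gamma>\<close>. For infinite
    \<open>\<gamma>\<close> the value \<open>g = 0\<close> is a default, and each use of the caps is
    guarded by \<open>\<gamma> < \<infinity>\<close>.\<close>
  define g where "g = real_of_ereal \<gamma>"
  define cap where "cap k = g * (1/2) ^ Suc k" for k
  have g: "\<gamma> = ereal g" "0 < g" if "\<gamma> < \<infinity>"
    using that gamma_pos by (cases \<gamma>; simp add: g_def)+
  have cap: "cap k \<in> ivl \<gamma> \<and> 0 < cap k" if fin: "\<gamma> < \<infinity>" for k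
  proof -
    have "(1/2 :: real) ^ Suc k < 1" by (rule power_Suc_less_one) auto
    then have "g * (1/2) ^ Suc k < g * 1"
      using g[OF fin] by (intro mult_strict_left_mono) auto
    then show ?thesis using g[OF fin] by (auto simp: cap_def ivl_def)
  qed
  have "\<forall>k. \<exists>u t. 0 < u \<and> 0 < t \<and> ereal t < \<gamma> \<and> (\<gamma> < \<infinity> \<longrightarrow> t \<le> cap k) \<and>
     ennreal (\<phi> u) * V (ennreal t) \<le> ennreal (\<epsilon> * (1/2) ^ Suc k) \<and>
     1 < ennreal (\<phi> ((1 + \<eta>) * u)) * V (ennreal t)"
    using assms cap by (intro allI bump_exists) auto
  then obtain u t where ut: "\<And>k. 0 < u k" "\<And>k. 0 < t k" "\<And>k. \<gamma> < \<infinity> \<longrightarrow> t k \<le> cap k"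
     "\<And>k. ennreal (\<phi> (u k)) * V (ennreal (t k)) \<le> ennreal (\<epsilon> * (1/2) ^ Suc k)"
     "\<And>k. 1 < ennreal (\<phi> ((1 + \<eta>) * u k)) * V (ennreal (t k))"
    by metis
  define a where "a n = (\<Sum>k<n. t k)" for n
  define A where "A n = {a n..<a (Suc n)}" for n
  have a_mono: "a m \<le> a n" if "m \<le> n" for m n
    unfolding a_def using that ut(2) by (intro sum_mono2) (auto intro: less_imp_le)
  have a_nonneg: "0 \<le> a n" for n
    unfolding a_def using ut(2) by (intro sum_nonneg) (auto intro: less_imp_le)
  have a_less: "ereal (a n) < \<gamma>" for n
  proof (cases "\<gamma> < \<infinity>")
    case True
    have "a n \<le> g * (1 - (1/2) ^ n)"
    proof (induction n)
      case (Suc n)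
      have "a (Suc n) = a n + t n" by (simp add: a_def)
      also have "t n \<le> cap n" using ut(3) True by blast
      finally show ?case using Suc by (simp add: cap_def algebra_simps)
    qed (simp add: a_def)
    also have "\<dots> < g * 1" using g[OF True] by (intro mult_strict_left_mono) auto
    finally show ?thesis using g[OF True] by simp
  qed simp
  have sub: "A k \<subseteq> ivl \<gamma>" for k
    using a_less[of "Suc k"] a_nonneg[of k]
    by (auto simp: A_def ivl_def intro: less_trans[of "ereal _" "ereal (a (Suc k))"])
  have meas: "A k \<in> sets M" for k
    using sub by (auto simp: sets_restrict_space_iff A_def)
  have em: "emeasure M (A k) = ennreal (t k)" for k
  proof -
    have "emeasure M (A k) = emeasure lebesgue (A k)"
      using sub by (intro emeasure_restrict_space) auto
    also have "\<dots> = emeasure lborel (A k)" by (simp add: A_def)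
    also have "\<dots> = ennreal (t k)"
      using ut(2)[of k] by (simp add: A_def a_def)
    finally show ?thesis .
  qed
  have disj: "disjoint_family A"
    unfolding disjoint_family_on_def
  proof (intro ballI impI)
    fix m n :: nat assume "m \<noteq> n"
    then show "A m \<inter> A n = {}"
      using a_mono[of "Suc m" n] a_mono[of "Suc n" m] by (cases m n rule: linorder_cases) (auto simp: A_def)
  qed
  have "fun_modular (\<lambda>x. u k * indicator (A k) x) \<le> ennreal (\<epsilon> * (1/2) ^ Suc k)" for k
    using ut(4)[of k] fun_modular_indicator[OF meas[of k], of "u k"] ut(1)[of k]
    by (simp only: em V_def less_imp_le)
  moreover have "1 < fun_modular (\<lambda>x. (1 + \<eta>) * u k * indicator (A k) x)" for k
  proof -
    have "0 \<le> (1 + \<eta>) * u k" using ut(1)[of k] assms by simp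
    from fun_modular_indicator[OF meas[of k] this] ut(5)[of k] show ?thesis
      by (simp only: em V_def)
  qed
  ultimately show ?thesis using meas disj ut(1) by blast
qed

text \<open>The room \<open>1 - b\<close> left by the modular of \<open>x\<close> is the budget
  \<open>\<epsilon>\<close> for the bumps. Replacing \<open>x\<close> on \<open>A k\<close> by plus
  or minus the bump keeps the supports disjoint, so the modulars add up to at most
  \<open>b + \<epsilon> = 1\<close>.\<close>

lemma perturbation:
  assumes x: "x \<in> olfun" "fun_modular x \<le> ennreal b" and b: "0 \<le> b" "b < 1" and eta: "0 < \<eta>"
  shows "\<exists>y z :: nat \<Rightarrow> real \<Rightarrow> real.
    (\<forall>k. y k \<in> olfun \<and> z k \<in> olfun \<and> fun_norm (y k) \<le> 1 \<and> fun_norm (z k) \<le> 1 \<and>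
         2 / (1 + \<eta>) \<le> fun_norm (\<lambda>t. y k t - z k t)) \<and>
    (\<forall>F \<in> dual \<gamma> \<phi> w. (\<lambda>k. F (ae_class (y k))) \<longlonglongrightarrow> F (ae_class x)) \<and>
    (\<forall>F \<in> dual \<gamma> \<phi> w. (\<lambda>k. F (ae_class (z k))) \<longlonglongrightarrow> F (ae_class x))"
proof -
  define \<epsilon> where "\<epsilon> = 1 - b"
  have eps: "0 < \<epsilon>" "\<epsilon> \<le> 1" using b by (auto simp: \<epsilon>_def)
  obtain A u where bumps: "\<forall>k::nat. A k \<in> sets M" "disjoint_family A" "\<forall>k. 0 < u k"
    "\<forall>k. fun_modular (\<lambda>x. u k * indicator (A k) x) \<le> ennreal (\<epsilon> * (1/2) ^ Suc k)"
    "\<forall>k. 1 < fun_modular (\<lambda>x. (1 + \<eta>) * u k * indicator (A k) x)"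
    using disjoint_bumps[OF eta eps(1)] by (elim exE conjE)
  note disj = bumps(2) and u = bumps(3)[rule_format] and small = bumps(4)[rule_format]
    and large = bumps(5)[rule_format]
  note [measurable] = bumps(1)[rule_format]
  note [measurable] = olfun_measurable[OF x(1)]
  define p where "p k t = u k * indicator (A k) t" for k t
  define q where "q k t = x t * indicator (A k) t" for k t
  have [measurable]: "p k \<in> borel_measurable M" "q k \<in> borel_measurable M" for k
    unfolding p_def q_def by measurable
  have p_ol: "p k \<in> olfun" for k
  proof (rule olfunI)
    have "fun_modular (p k) \<le> ennreal (\<epsilon> * (1/2) ^ Suc k)"
      using small[of k] by (simp only: p_def[abs_def])
    then show "fun_modular (p k) < \<infinity>" by (rule le_less_trans) simp
  qed measurable
  \<comment> \<open>The pieces of \<open>x\<close> live on disjoint sets, so every such signed sum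
    is dominated by \<open>\<bar>x\<bar>\<close>.\<close>
  have fun_modular_q: "fun_modular (\<lambda>t. \<Sum>k<n. c k * q k t) \<le> ennreal b" if c: "\<And>k. \<bar>c k\<bar> \<le> 1" for c :: "nat \<Rightarrow> real" and n
  proof -
    have "\<bar>\<Sum>k<n. c k * q k t\<bar> \<le> \<bar>x t\<bar>" for t
    proof -
      have "\<bar>\<Sum>k<n. c k * q k t\<bar> \<le> (\<Sum>k<n. \<bar>x t\<bar> * indicator (A k) t)"
      proof (intro order_trans[OF sum_abs] sum_mono)
        fix k
        have "\<bar>c k * q k t\<bar> = \<bar>c k\<bar> * (\<bar>x t\<bar> * indicator (A k) t)"
          by (simp add: q_def abs_mult)
        also have "\<dots> \<le> 1 * (\<bar>x t\<bar> * indicator (A k) t)"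
          using c by (intro mult_right_mono) auto
        finally show "\<bar>c k * q k t\<bar> \<le> \<bar>x t\<bar> * indicator (A k) t" by simp
      qed
      also have "\<dots> = \<bar>x t\<bar> * (\<Sum>k<n. indicator (A k) t)"
        by (simp add: sum_distrib_left)
      also have "(\<Sum>k<n. indicator (A k) t) = (indicator (\<Union>k<n. A k) t :: real)"
        using disj by (intro indicator_UN_disjoint[symmetric])
          (auto simp: disjoint_family_on_def)
      also have "\<bar>x t\<bar> * indicator (\<Union>k<n. A k) t \<le> \<bar>x t\<bar> * 1"
        by (intro mult_left_mono) (auto simp: indicator_def)
      finally show ?thesis by simp
    qed
    then have "fun_modular (\<lambda>t. \<Sum>k<n. c k * q k t) \<le> fun_modular x"
      by (intro fun_modular_mono) auto
    with x(2) show ?thesis by simp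
  qed
  have q_ol: "q k \<in> olfun" for k
  proof (rule olfunI)
    have "fun_modular (q k) \<le> fun_modular x"
      by (intro fun_modular_mono) (auto simp: q_def indicator_def)
    also have "\<dots> < \<infinity>" using x(2) by (rule le_less_trans) simp
    finally show "fun_modular (q k) < \<infinity>" .
  qed measurable
  \<comment> \<open>The budgets are at most \<open>(1/2) ^ Suc k\<close>, and
    \<open>1 - (1/2) ^ n\<close> is their exact partial sum, which makes the induction
    close.\<close>
  have fun_modular_p: "fun_modular (\<lambda>t. \<Sum>k<n. c k * p k t) \<le> ennreal (1 - (1/2) ^ n)" if c: "\<And>k. \<bar>c k\<bar> \<le> 1" for c :: "nat \<Rightarrow> real" and n
  proof (induction n)
    case 0
    show ?case using fun_modular_indicator[of "{}" 0] by simp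
  next
    case (Suc n)
    have "fun_modular (\<lambda>t. (\<Sum>k<n. c k * p k t) + c n * p n t) \<le> fun_modular (\<lambda>t. \<Sum>k<n. c k * p k t) + fun_modular (\<lambda>t. c n * p n t)"
    proof (rule fun_modular_disjoint)
      fix t
      show "(\<Sum>k<n. c k * p k t) = 0 \<or> c n * p n t = 0"
      proof (cases "t \<in> A n")
        case True
        have "c k * p k t = 0" if "k \<in> {..<n}" for k
        proof -
          have "A k \<inter> A n = {}"
            using disjoint_family_onD[OF disj, of k n] that by simp
          with True have "t \<notin> A k" by blast
          then show ?thesis by (simp add: p_def)
        qed
        then show ?thesis by (intro disjI1 sum.neutral ballI)
      next
        case False
        then show ?thesis by (simp add: p_def)
      qed
    next
      show "(\<lambda>t. \<Sum>k<n. c k * p k t) \<in> borel_measurable M" by measurable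
      show "(\<lambda>t. c n * p n t) \<in> borel_measurable M" by measurable
    qed
    also have "\<dots> \<le> ennreal (1 - (1/2) ^ n) + ennreal ((1/2) ^ Suc n)"
    proof (intro add_mono Suc)
      have "fun_modular (\<lambda>t. c n * p n t) \<le> fun_modular (p n)"
      proof (rule fun_modular_mono)
        have "\<bar>c n * p n t\<bar> \<le> 1 * \<bar>p n t\<bar>" for t
          unfolding abs_mult using c[of n] by (intro mult_right_mono) auto
        then show "AE t in M. \<bar>c n * p n t\<bar> \<le> \<bar>p n t\<bar>" by simp
      qed measurable
      also have "\<dots> \<le> ennreal (\<epsilon> * (1/2) ^ Suc n)" using small[of n] by (simp only: p_def[abs_def])
      also have "\<dots> \<le> ennreal ((1/2) ^ Suc n)"
        using eps by (intro ennreal_leI mult_left_le_one_le) auto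
      finally show "fun_modular (\<lambda>t. c n * p n t) \<le> ennreal ((1/2) ^ Suc n)" .
    qed
    also have "\<dots> = ennreal (1 - (1/2) ^ Suc n)"
      by (subst ennreal_plus[symmetric]) (auto simp: power_le_one)
    finally show ?case by simp
  qed
  have p_null: "(\<lambda>k. F (ae_class (p k))) \<longlonglongrightarrow> 0" if "F \<in> dual \<gamma> \<phi> w" for F
  proof (rule weakly_null[OF that p_ol])
    fix n and c :: "nat \<Rightarrow> real" assume c: "\<And>k. \<bar>c k\<bar> \<le> 1"
    have "fun_modular (\<lambda>x. \<Sum>k<n. c k * p k x) \<le> ennreal (1 - (1/2) ^ n)"
      by (rule fun_modular_p[OF c])
    also have "\<dots> \<le> ennreal 1" by (intro ennreal_leI) simp
    finally show "fun_modular (\<lambda>x. \<Sum>k<n. c k * p k x) \<le> 1" by simp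
  qed
  have q_null: "(\<lambda>k. F (ae_class (q k))) \<longlonglongrightarrow> 0" if "F \<in> dual \<gamma> \<phi> w" for F
  proof (rule weakly_null[OF that q_ol])
    fix n and c :: "nat \<Rightarrow> real" assume c: "\<And>k. \<bar>c k\<bar> \<le> 1"
    have "fun_modular (\<lambda>x. \<Sum>k<n. c k * q k x) \<le> ennreal b"
      by (rule fun_modular_q[OF c])
    also have "\<dots> \<le> ennreal 1" using b by (intro ennreal_leI) simp
    finally show "fun_modular (\<lambda>x. \<Sum>k<n. c k * q k x) \<le> 1" by simp
  qed
  define Y where "Y s k t = (x t - q k t) + s * p k t" for s k t
  have Y_ol: "Y s k \<in> olfun" for s k
  proof -
    have "(\<lambda>t. (x t + (-1) * q k t) + s * p k t) \<in> olfun"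
      by (intro olfun_add olfun_scale x p_ol q_ol)
    then show ?thesis by (simp add: Y_def[abs_def])
  qed
  have Y_norm: "fun_norm (Y s k) \<le> 1" if s: "\<bar>s\<bar> = 1" for s k
  proof (rule fun_norm_le)
    have "fun_modular (Y s k) \<le> fun_modular (\<lambda>t. x t - q k t) + fun_modular (\<lambda>t. s * p k t)"
      unfolding Y_def[abs_def]
      by (rule fun_modular_disjoint) (auto simp: p_def q_def indicator_def)
    also have "\<dots> \<le> ennreal b + ennreal \<epsilon>"
    proof (rule add_mono)
      have "fun_modular (\<lambda>t. x t - q k t) \<le> fun_modular x"
        by (intro fun_modular_mono) (auto simp: q_def indicator_def)
      with x(2) show "fun_modular (\<lambda>t. x t - q k t) \<le> ennreal b" by simp
      have "fun_modular (\<lambda>t. s * p k t) \<le> fun_modular (p k)"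
        using s by (intro fun_modular_mono) (auto simp: abs_mult)
      also have "\<dots> \<le> ennreal (\<epsilon> * (1/2) ^ Suc k)" using small[of k] by (simp only: p_def[abs_def])
      also have "\<dots> \<le> ennreal \<epsilon>"
        using eps by (intro ennreal_leI mult_right_le_one_le power_le_one) auto
      finally show "fun_modular (\<lambda>t. s * p k t) \<le> ennreal \<epsilon>" .
    qed
    also have "\<dots> = 1" using b by (simp add: \<epsilon>_def flip: ennreal_plus)
    finally show "fun_modular (\<lambda>t. 1 / 1 * Y s k t) \<le> 1" by simp
  qed simp
  have Y_lim: "(\<lambda>k. F (ae_class (Y s k))) \<longlonglongrightarrow> F (ae_class x)" if F: "F \<in> dual \<gamma> \<phi> w" for F s
  proof -
    have "F (ae_class (Y s k)) = F (ae_class x) - F (ae_class (q k)) + s * F (ae_class (p k))" for k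
    proof -
      have diff: "(\<lambda>t. x t - q k t) \<in> olfun"
        using olfun_add[OF x(1) olfun_scale[OF q_ol, of "-1"]] by simp
      have "F (ae_class (Y s k)) = F (ae_class (\<lambda>t. x t - q k t)) + F (ae_class (\<lambda>t. s * p k t))"
        unfolding Y_def[abs_def] by (intro dual_add F diff olfun_scale p_ol)
      then show ?thesis
        by (simp only: dual_diff[OF F x(1) q_ol] dual_scale[OF F p_ol])
    qed
    moreover have "(\<lambda>k. F (ae_class x) - F (ae_class (q k)) + s * F (ae_class (p k))) \<longlonglongrightarrow> F (ae_class x) - 0 + s * 0"
      by (intro tendsto_intros p_null q_null F)
    ultimately show ?thesis by simp
  qed
  have "2 / (1 + \<eta>) \<le> fun_norm (\<lambda>t. Y 1 k t - Y (-1) k t)" for k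
  proof (rule fun_norm_ge)
    have eq: "(\<lambda>t. Y 1 k t - Y (-1) k t) = (\<lambda>t. 2 * p k t)"
      by (auto simp: Y_def)
    show "(\<lambda>t. Y 1 k t - Y (-1) k t) \<in> olfun"
      unfolding eq by (intro olfun_scale p_ol)
    \<comment> \<open>The difference is \<open>2 * p k\<close>; dividing it by
      \<open>2 / (1 + \<eta>)\<close> gives exactly the enlarged bump of modular above 1.\<close>
    have "(\<lambda>t. 1 / (2 / (1 + \<eta>)) * (Y 1 k t - Y (-1) k t)) = (\<lambda>x. (1 + \<eta>) * u k * indicator (A k) x)"
      using eta by (auto simp: Y_def p_def)
    with large[of k] show "1 < fun_modular (\<lambda>t. 1 / (2 / (1 + \<eta>)) * (Y 1 k t - Y (-1) k t))" by simp
  qed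
  with Y_ol Y_norm Y_lim show ?thesis
    by (intro exI[of _ "Y 1"] exI[of _ "Y (-1)"]) auto
qed

end

section \<open>The diameter of a weakly open subset of the ball\<close>

theorem theorem2p6:
  fixes \<gamma> :: ereal and w \<phi> :: "real \<Rightarrow> real" and S :: "(real \<Rightarrow> real) set set"
  assumes "0 < \<gamma>"
    and "weight_function \<gamma> w"
    and "\<gamma> = \<infinity> \<Longrightarrow> W w \<infinity> = \<infinity>"
    and "orlicz_N_function \<phi>"
    and "(\<gamma> = \<infinity> \<and> \<not> Delta2 \<phi>) \<or> (\<gamma> < \<infinity> \<and> \<not> Delta2_infinity \<phi>)"
    and "openin (subtopology (weak_topology \<gamma> \<phi> w) (unit_ball \<gamma> \<phi> w)) S"
    and "S \<noteq> {}"
  shows "lux_diameter \<gamma> \<phi> w S = 2"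
proof -
  interpret orlicz_lorentz_space_not_Delta2 \<gamma> w \<phi>
  proof
    show "orlicz_function \<phi>" using assms(4) by (simp add: orlicz_N_function_def)
  qed (fact assms)+
  obtain U where U: "openin (weak_topology \<gamma> \<phi> w) U" "S = U \<inter> unit_ball \<gamma> \<phi> w"
    using assms(6) by (auto simp: openin_subtopology)
  obtain f where f: "f \<in> olfun" "fun_norm f \<le> 1" "ae_class f \<in> U"
    using assms(7) U(2) by (auto simp: unit_ball_eq)
  \<comment> \<open>A sequence in (0, 1), starting at 1/2 and tending to 1.\<close>
  define b where "b n = 1 - inverse (real (Suc n)) / 2" for n :: nat
  have b: "0 < b n" "b n < 1" for n by (auto simp: b_def field_simps)
  have "b \<longlonglongrightarrow> 1 - 0 / 2"
    unfolding b_def[abs_def] by (intro tendsto_intros LIMSEQ_inverse_real_of_nat) simp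
  then have b_lim: "b \<longlonglongrightarrow> 1" by simp
  \<comment> \<open>The factor is squared on purpose: one \<open>b n\<close> turns norm at most 1
    into modular at most 1, the other lowers the modular to at most \<open>b n < 1\<close>, as
    \<open>perturbation\<close> requires.\<close>
  have "eventually (\<lambda>n. ae_class (\<lambda>t. (b n * b n) * f t) \<in> U) sequentially"
  proof (rule eventually_in_weakly_open[OF U(1) f(3)])
    fix F assume F: "F \<in> dual \<gamma> \<phi> w"
    have "(\<lambda>n. (b n * b n) * F (ae_class f)) \<longlonglongrightarrow> (1 * 1) * F (ae_class f)"
      by (intro tendsto_intros b_lim)
    then show "(\<lambda>n. F (ae_class (\<lambda>t. (b n * b n) * f t))) \<longlonglongrightarrow> F (ae_class f)"
      by (simp add: dual_scale[OF F f(1)])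
  qed (rule olfun_scale[OF f(1)])
  then obtain n where n: "ae_class (\<lambda>t. (b n * b n) * f t) \<in> U"
    by (auto simp: eventually_sequentially)
  define x where "x t = (b n * b n) * f t" for t
  have x: "x \<in> olfun" "ae_class x \<in> U"
    using n olfun_scale[OF f(1)] by (auto simp: x_def[abs_def])
  have "fun_modular x = fun_modular (\<lambda>t. b n * (b n * f t))"
    by (simp add: x_def[abs_def] mult.assoc)
  also have "\<dots> \<le> ennreal (b n) * fun_modular (\<lambda>t. b n * f t)"
    using b[of n] olfun_measurable[OF f(1)] by (intro fun_modular_shrink) auto
  also have "\<dots> \<le> ennreal (b n) * 1"
  proof (rule mult_left_mono)
    have "1 < 1 / b n" using b[of n] by simp
    with f(2) have "fun_norm f < 1 / b n" by linarith
    from fun_modular_le_1[OF f(1) this] show "fun_modular (\<lambda>t. b n * f t) \<le> 1" by simp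
  qed simp
  finally have fun_modular_x: "fun_modular x \<le> ennreal (b n)" by simp
  have lower: "ereal (2 / (1 + \<eta>)) \<le> lux_diameter \<gamma> \<phi> w S" if eta: "0 < \<eta>" for \<eta>
  proof -
    obtain y z where
      "\<forall>k. y k \<in> olfun \<and> z k \<in> olfun \<and> fun_norm (y k) \<le> 1 \<and> fun_norm (z k) \<le> 1 \<and>
        2 / (1 + \<eta>) \<le> fun_norm (\<lambda>t. y k t - z k t)"
      and lim: "\<forall>F \<in> dual \<gamma> \<phi> w. (\<lambda>k. F (ae_class (y k))) \<longlonglongrightarrow> F (ae_class x)"
        "\<forall>F \<in> dual \<gamma> \<phi> w. (\<lambda>k. F (ae_class (z k))) \<longlonglongrightarrow> F (ae_class x)"
      using perturbation[OF x(1) fun_modular_x less_imp_le[OF b(1)] b(2) eta] by (elim exE conjE)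
    then have yz: "y k \<in> olfun" "z k \<in> olfun" "fun_norm (y k) \<le> 1" "fun_norm (z k) \<le> 1"
      "2 / (1 + \<eta>) \<le> fun_norm (\<lambda>t. y k t - z k t)" for k
      by auto
    have "eventually (\<lambda>k. ae_class (y k) \<in> U \<and> ae_class (z k) \<in> U) sequentially"
      by (intro eventually_conj eventually_in_weakly_open[OF U(1) x(2)] yz lim[rule_format])
    then obtain k where k: "ae_class (y k) \<in> U" "ae_class (z k) \<in> U"
      by (auto simp: eventually_sequentially)
    have "ae_class (y k) \<in> S" "ae_class (z k) \<in> S"
      using k yz by (auto simp: U(2) unit_ball_eq)
    then have "ereal (lux_norm \<gamma> \<phi> w (L0_diff \<gamma> (ae_class (y k)) (ae_class (z k)))) \<le> lux_diameter \<gamma> \<phi> w S"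
      unfolding lux_diameter_def by (intro SUP_upper2[of "(ae_class (y k), ae_class (z k))"]) auto
    moreover have "lux_norm \<gamma> \<phi> w (L0_diff \<gamma> (ae_class (y k)) (ae_class (z k))) = fun_norm (\<lambda>t. y k t - z k t)"
      using yz(1,2)[THEN olfun_measurable] by (simp add: L0_diff_ae_class lux_norm_ae_class)
    ultimately show ?thesis using yz(5)[of k] by (auto intro: order_trans[of _ "ereal (fun_norm (\<lambda>t. y k t - z k t))"])
  qed
  show ?thesis
  proof (rule antisym)
    show "lux_diameter \<gamma> \<phi> w S \<le> 2"
      unfolding lux_diameter_def
    proof (rule SUP_least, clarify)
      fix X Y assume "X \<in> S" "Y \<in> S"
      then obtain g h where "g \<in> olfun" "fun_norm g \<le> 1" "X = ae_class g" "h \<in> olfun" "fun_norm h \<le> 1" "Y = ae_class h"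
        by (auto simp: U(2) unit_ball_eq)
      moreover from this have "(\<lambda>t. g t - h t) \<in> borel_measurable M"
        by (intro borel_measurable_diff olfun_measurable)
      ultimately show "ereal (lux_norm \<gamma> \<phi> w (L0_diff \<gamma> X Y)) \<le> 2"
        using fun_norm_diff_le[of g h] by (simp add: L0_diff_ae_class lux_norm_ae_class olfun_measurable)
    qed
    \<comment> \<open>The bound \<open>lower\<close> is used for
      \<open>\<eta> = 1 / (n + 1)\<close>, and the limit gives 2.\<close>
    have "(\<lambda>n. ereal (2 / (1 + inverse (real (Suc n))))) \<longlonglongrightarrow> ereal (2 / (1 + 0))"
      unfolding lim_ereal by (intro tendsto_intros LIMSEQ_inverse_real_of_nat) simp
    then have "ereal (2 / (1 + 0)) \<le> lux_diameter \<gamma> \<phi> w S"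
      by (rule LIMSEQ_le_const2) (auto intro!: exI[of _ 0] lower)
    then show "2 \<le> lux_diameter \<gamma> \<phi> w S" by simp
  qed
qed

end
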